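(* (In NF.) Let $\mathbf{C}$ be an internal category in $\mathbf{N}$, with object of objects $C_0$, object of morphisms $C_1$, domain and codomain maps $d_0,d_1:C_1\to C_0$, composition $m$ and identities $i$. Let $F=(F_0,\gamma_0,e)$ be a covariant presheaf (internal diagram) on $\mathbf{C}$, and let $U$ be an object of $\mathbf{C}$, i.e. a morphism $u:1\to C_0$. Then there are bijections $$\mathrm{Nat}(\mathbf{C}(U,-),F)\;\cong\;\mathbf{N}(1,F(U))\;\cong\;T(F(U)).$$ Furthermore, the set of natural transformations $\mathrm{Nat}(\mathbf{C}(U,-),F)$ is the same size as a set of singletons.
   Context: NF is the set theory axiomatised by extensionality and comprehension for stratifiable formulae (a formula is stratifiable if natural numbers can be assigned to its variables so that $x=y$ forces equal values and $x\in y$ forces the value of $y$ to be one more than that of $x$). Ordered pairs are type-level Quine pairs. $\mathbf{N}$ is the category of all NF sets and all functions whose graphs are sets; $1$ is a fixed singleton set and $\mathbf{N}(1,X)$ is the set of functions $1\to X$. $T:\mathbf{N}\to\mathbf{N}$ is the functor with $TX=\iota``X=\{\{x\}:x\in X\}$ and $Tf(\{a\})=\{f(a)\}$. A "set of singletons" is a set all of whose members are singletons. An internal category in $\mathbf{N}$ consists of sets $C_0,C_1$ with maps $d_0,d_1:C_1\to C_0$, $i:C_0\to C_1$, $m:C_1\times_{C_0}C_1\to C_1$ satisfying the usual category axioms. An internal diagram (covariant presheaf) $F$ on $\mathbf{C}$ is a triple $(F_0,\gamma_0,e)$ with $\gamma_0:F_0\to C_0$ and $e:F_0\times_{C_0}C_1\to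 F_0$ (pullback of $\gamma_0$ along $d_0$) such that $\gamma_0 e=d_1\pi_2$, $e(1\times i)=1_{F_0}$, and $e(e\times 1)=e(1\times m)$ on $F_0\times_{C_0}C_1\times_{C_0}C_1$. Morphisms of internal diagrams (natural transformations) are maps $F_0\to F_0'$ over $C_0$ commuting with the actions $e,e'$; $\mathrm{Nat}(F,F')$ is the set of these. $\mathbf{C}(U,-)$ denotes the representable diagram $R(u)$: its underlying set is $1\times_{C_0}C_1$ (the pullback of $u$ along $d_0$, i.e. the morphisms of $\mathbf{C}$ with domain $U$), its map to $C_0$ is $d_1\pi_2$, and its action is given by composition $1\times m$. $F(U)$ denotes the pullback of $\gamma_0:F_0\to C_0$ along $u:1\to C_0$ (the fibre of $\gamma_0$ over $U$). *)

theory Defs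
  imports Main
begin

section \<open>Models of NF\<close>

datatype fm =
    Eq nat nat
  | Mem nat nat
  | Neg fm
  | Conj fm fm
  | All nat fm

primrec sat :: "('v \<Rightarrow> 'v \<Rightarrow> bool) \<Rightarrow> fm \<Rightarrow> (nat \<Rightarrow> 'v) \<Rightarrow> bool" where
  "sat E (Eq x y) s \<longleftrightarrow> s x = s y"
| "sat E (Mem x y) s \<longleftrightarrow> E (s x) (s y)"
| "sat E (Neg p) s \<longleftrightarrow> \<not> sat E p s"
| "sat E (Conj p q) s \<longleftrightarrow> sat E p s \<and> sat E q s"
| "sat E (All x p) s \<longleftrightarrow> (\<forall>a. sat E p (s(x := a)))"

text \<open>
  A variable name gets a single level throughout a formula. A formula that binds the same name
  at different levels has to be renamed first, which does not change what it defines.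
\<close>

primrec stratified_by :: "(nat \<Rightarrow> nat) \<Rightarrow> fm \<Rightarrow> bool" where
  "stratified_by l (Eq x y) \<longleftrightarrow> l x = l y"
| "stratified_by l (Mem x y) \<longleftrightarrow> l y = l x + 1"
| "stratified_by l (Neg p) \<longleftrightarrow> stratified_by l p"
| "stratified_by l (Conj p q) \<longleftrightarrow> stratified_by l p \<and> stratified_by l q"
| "stratified_by l (All x p) \<longleftrightarrow> stratified_by l p"

definition stratifiable :: "fm \<Rightarrow> bool" where
  "stratifiable p \<longleftrightarrow> (\<exists>l. stratified_by l p)"

text \<open>
  A type of class \<open>nf\<close> is (the universe of) a model of NF. In the comprehension scheme, variable 0
  is the one being collected; the environment \<open>s\<close> supplies values for the parameters.
\<close>

class nf =
  fixes mem :: "'a \<Rightarrow> 'a \<Rightarrow> bool" (infix \<open>\<in>\<^sub>N\<close> 50)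
  assumes extensionality: "(\<And>z. z \<in>\<^sub>N x \<longleftrightarrow> z \<in>\<^sub>N y) \<Longrightarrow> x = y"
    and comprehension: "stratifiable p \<Longrightarrow> \<exists>y. \<forall>x. x \<in>\<^sub>N y \<longleftrightarrow> sat (\<in>\<^sub>N) p (s(0 := x))"

text \<open>
  \<open>COLL x. P x\<close> is the set of the model with extension \<open>P\<close>. It is meaningful only if there
  is such a set, as is the case for stratifiable \<open>P\<close>.
\<close>

definition coll :: "('v::nf \<Rightarrow> bool) \<Rightarrow> 'v" (binder \<open>COLL \<close> 10) where
  "coll P = (THE y. \<forall>x. x \<in>\<^sub>N y \<longleftrightarrow> P x)"

definition empty :: "'v::nf" where
  "empty = (COLL x. False)"

definition sing :: "'v::nf \<Rightarrow> 'v" where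
  "sing a = (COLL x. x = a)"

definition adjoin :: "'v::nf \<Rightarrow> 'v \<Rightarrow> 'v" where
  "adjoin A a = (COLL x. x \<in>\<^sub>N A \<or> x = a)"


section \<open>Quine pairs\<close>

text \<open>Frege naturals: \<open>n\<close> is the set of all sets with \<open>n\<close> elements.\<close>

definition zero :: "'v::nf" where
  "zero = sing empty"

definition succ :: "'v::nf \<Rightarrow> 'v" where
  "succ n = (COLL z. \<exists>A a. A \<in>\<^sub>N n \<and> \<not> a \<in>\<^sub>N A \<and> z = adjoin A a)"

definition nats :: "'v::nf" where
  "nats = (COLL n. \<forall>X. zero \<in>\<^sub>N X \<and> (\<forall>k. k \<in>\<^sub>N X \<longrightarrow> succ k \<in>\<^sub>N X) \<longrightarrow> n \<in>\<^sub>N X)"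

definition shift :: "'v::nf \<Rightarrow> 'v" where
  "shift A = (COLL z. \<exists>a. a \<in>\<^sub>N A \<and> z = (if a \<in>\<^sub>N nats then succ a else a))"

definition pair :: "'v::nf \<Rightarrow> 'v \<Rightarrow> 'v" (\<open>\<langle>_, _\<rangle>\<close>) where
  "\<langle>A, B\<rangle> = (COLL z. (\<exists>a. a \<in>\<^sub>N A \<and> z = shift a) \<or> (\<exists>b. b \<in>\<^sub>N B \<and> z = adjoin (shift b) zero))"


section \<open>The category of sets and functions\<close>

definition is_fun :: "'v::nf \<Rightarrow> 'v \<Rightarrow> 'v \<Rightarrow> bool" where
  "is_fun f X Y \<longleftrightarrow>
     (\<forall>p. p \<in>\<^sub>N f \<longrightarrow> (\<exists>x y. x \<in>\<^sub>N X \<and> y \<in>\<^sub>N Y \<and> p = \<langle>x, y\<rangle>)) \<and>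
     (\<forall>x. x \<in>\<^sub>N X \<longrightarrow> (\<exists>!y. \<langle>x, y\<rangle> \<in>\<^sub>N f))"

definition app :: "'v::nf \<Rightarrow> 'v \<Rightarrow> 'v" (infixl \<open>\<cdot>\<close> 90) where
  "f \<cdot> x = (THE y. \<langle>x, y\<rangle> \<in>\<^sub>N f)"

definition is_bij :: "'v::nf \<Rightarrow> 'v \<Rightarrow> 'v \<Rightarrow> bool" where
  "is_bij f X Y \<longleftrightarrow> is_fun f X Y \<and> (\<forall>y. y \<in>\<^sub>N Y \<longrightarrow> (\<exists>!x. \<langle>x, y\<rangle> \<in>\<^sub>N f))"

definition same_size :: "'v::nf \<Rightarrow> 'v \<Rightarrow> bool" (infix \<open>\<cong>\<close> 50) where
  "X \<cong> Y \<longleftrightarrow> (\<exists>f. is_bij f X Y)"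

definition Hom :: "'v::nf \<Rightarrow> 'v \<Rightarrow> 'v" where
  "Hom X Y = (COLL f. is_fun f X Y)"

definition T :: "'v::nf \<Rightarrow> 'v" where
  "T X = (COLL z. \<exists>x. x \<in>\<^sub>N X \<and> z = sing x)"

definition singleton_set :: "'v::nf \<Rightarrow> bool" where
  "singleton_set z \<longleftrightarrow> (\<exists>a. z = sing a)"

definition set_of_singletons :: "'v::nf \<Rightarrow> bool" where
  "set_of_singletons S \<longleftrightarrow> (\<forall>z. z \<in>\<^sub>N S \<longrightarrow> singleton_set z)"

definition pullback :: "'v::nf \<Rightarrow> 'v \<Rightarrow> 'v \<Rightarrow> 'v \<Rightarrow> 'v" where
  "pullback X f Y g = (COLL p. \<exists>x y. x \<in>\<^sub>N X \<and> y \<in>\<^sub>N Y \<and> f \<cdot> x = g \<cdot> y \<and> p = \<langle>x, y\<rangle>)"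


section \<open>Internal categories and internal diagrams\<close>

record 'v icat =
  C0 :: 'v
  C1 :: 'v
  d0 :: 'v
  d1 :: 'v
  idn :: 'v
  cmp :: 'v

text \<open>
  Composition is written in diagrammatic order: \<open>cmp C \<cdot> \<langle>f, g\<rangle>\<close> is \<open>f\<close> followed by \<open>g\<close>.
\<close>

definition internal_category :: "'v::nf icat \<Rightarrow> bool" where
  "internal_category C \<longleftrightarrow>
     is_fun (d0 C) (C1 C) (C0 C) \<and>
     is_fun (d1 C) (C1 C) (C0 C) \<and>
     is_fun (idn C) (C0 C) (C1 C) \<and>
     is_fun (cmp C) (pullback (C1 C) (d1 C) (C1 C) (d0 C)) (C1 C) \<and>
     (\<forall>a. a \<in>\<^sub>N C0 C \<longrightarrow> d0 C \<cdot> (idn C \<cdot> a) = a \<and> d1 C \<cdot> (idn C \<cdot> a) = a) \<and>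
     (\<forall>f g. f \<in>\<^sub>N C1 C \<and> g \<in>\<^sub>N C1 C \<and> d1 C \<cdot> f = d0 C \<cdot> g \<longrightarrow>
        d0 C \<cdot> (cmp C \<cdot> \<langle>f, g\<rangle>) = d0 C \<cdot> f \<and> d1 C \<cdot> (cmp C \<cdot> \<langle>f, g\<rangle>) = d1 C \<cdot> g) \<and>
     (\<forall>f. f \<in>\<^sub>N C1 C \<longrightarrow>
        cmp C \<cdot> \<langle>idn C \<cdot> (d0 C \<cdot> f), f\<rangle> = f \<and> cmp C \<cdot> \<langle>f, idn C \<cdot> (d1 C \<cdot> f)\<rangle> = f) \<and>
     (\<forall>f g h. f \<in>\<^sub>N C1 C \<and> g \<in>\<^sub>N C1 C \<and> h \<in>\<^sub>N C1 C \<and>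
        d1 C \<cdot> f = d0 C \<cdot> g \<and> d1 C \<cdot> g = d0 C \<cdot> h \<longrightarrow>
        cmp C \<cdot> \<langle>cmp C \<cdot> \<langle>f, g\<rangle>, h\<rangle> = cmp C \<cdot> \<langle>f, cmp C \<cdot> \<langle>g, h\<rangle>\<rangle>)"

record 'v idiag =
  F0 :: 'v
  gam :: 'v
  act :: 'v

definition internal_diagram :: "'v::nf icat \<Rightarrow> 'v idiag \<Rightarrow> bool" where
  "internal_diagram C F \<longleftrightarrow>
     is_fun (gam F) (F0 F) (C0 C) \<and>
     is_fun (act F) (pullback (F0 F) (gam F) (C1 C) (d0 C)) (F0 F) \<and>
     (\<forall>x f. x \<in>\<^sub>N F0 F \<and> f \<in>\<^sub>N C1 C \<and> gam F \<cdot> x = d0 C \<cdot> f \<longrightarrow>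
        gam F \<cdot> (act F \<cdot> \<langle>x, f\<rangle>) = d1 C \<cdot> f) \<and>
     (\<forall>x. x \<in>\<^sub>N F0 F \<longrightarrow> act F \<cdot> \<langle>x, idn C \<cdot> (gam F \<cdot> x)\<rangle> = x) \<and>
     (\<forall>x f g. x \<in>\<^sub>N F0 F \<and> f \<in>\<^sub>N C1 C \<and> g \<in>\<^sub>N C1 C \<and>
        gam F \<cdot> x = d0 C \<cdot> f \<and> d1 C \<cdot> f = d0 C \<cdot> g \<longrightarrow>
        act F \<cdot> \<langle>act F \<cdot> \<langle>x, f\<rangle>, g\<rangle> = act F \<cdot> \<langle>x, cmp C \<cdot> \<langle>f, g\<rangle>\<rangle>)"

definition is_nat_trans :: "'v::nf icat \<Rightarrow> 'v idiag \<Rightarrow> 'v idiag \<Rightarrow> 'v \<Rightarrow> bool" where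
  "is_nat_trans C F G t \<longleftrightarrow>
     is_fun t (F0 F) (F0 G) \<and>
     (\<forall>x. x \<in>\<^sub>N F0 F \<longrightarrow> gam G \<cdot> (t \<cdot> x) = gam F \<cdot> x) \<and>
     (\<forall>x f. x \<in>\<^sub>N F0 F \<and> f \<in>\<^sub>N C1 C \<and> gam F \<cdot> x = d0 C \<cdot> f \<longrightarrow>
        t \<cdot> (act F \<cdot> \<langle>x, f\<rangle>) = act G \<cdot> \<langle>t \<cdot> x, f\<rangle>)"

definition NatTrans :: "'v::nf icat \<Rightarrow> 'v idiag \<Rightarrow> 'v idiag \<Rightarrow> 'v" where
  "NatTrans C F G = (COLL t. is_nat_trans C F G t)"

definition rep_set :: "'v::nf icat \<Rightarrow> 'v \<Rightarrow> 'v \<Rightarrow> 'v" where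
  "rep_set C one u = pullback one u (C1 C) (d0 C)"

definition rep_map :: "'v::nf icat \<Rightarrow> 'v \<Rightarrow> 'v \<Rightarrow> 'v" where
  "rep_map C one u =
     (COLL p. \<exists>a f. \<langle>a, f\<rangle> \<in>\<^sub>N rep_set C one u \<and> p = \<langle>\<langle>a, f\<rangle>, d1 C \<cdot> f\<rangle>)"

definition rep_act :: "'v::nf icat \<Rightarrow> 'v \<Rightarrow> 'v \<Rightarrow> 'v" where
  "rep_act C one u =
     (COLL p. \<exists>a f g.
        \<langle>\<langle>a, f\<rangle>, g\<rangle> \<in>\<^sub>N pullback (rep_set C one u) (rep_map C one u) (C1 C) (d0 C) \<and>
        p = \<langle>\<langle>\<langle>a, f\<rangle>, g\<rangle>, \<langle>a, cmp C \<cdot> \<langle>f, g\<rangle>\<rangle>\<rangle>)"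

definition representable :: "'v::nf icat \<Rightarrow> 'v \<Rightarrow> 'v \<Rightarrow> 'v idiag" where
  "representable C one u =
     \<lparr>F0 = rep_set C one u, gam = rep_map C one u, act = rep_act C one u\<rparr>"

definition fibre :: "'v::nf idiag \<Rightarrow> 'v \<Rightarrow> 'v \<Rightarrow> 'v" where
  "fibre F one u = pullback (F0 F) (gam F) one u"

end

theory Submission
  imports Defs "HOL-Library.Nat_Bijection"
begin

text \<open>
  The Yoneda argument itself is the usual one: a natural transformation \<open>t\<close> out of \<open>C(U,-)\<close> is
  determined by its value at the identity of \<open>U\<close>, because every \<open>f\<close> out of \<open>U\<close> is the identity acted
  on by \<open>f\<close>, and each element of the fibre over \<open>U\<close> occurs as such a value. What NF changes is the
  bookkeeping of types. The map from \<open>t\<close> to its value at the identity lowers the type by one and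
  has no stratified definition; the map to the singleton of that value has one
  (lemma \<open>yoneda\<close>). In the same way a function \<open>1 \<rightarrow> X\<close> lies one type above its value, so \<open>Hom 1 X\<close> is the size of \<open>T X\<close>
  (\<open>Hom_singleton_same_size\<close>), and the bijection with \<open>N(1,F(U))\<close> is the composite of the two. As
  \<open>T (F(U))\<close> is a set of singletons, the last claim comes for free.

  Two things have to be established before this argument can be run inside an arbitrary model.

  First, every set and function used above must exist, and the only source of sets is comprehension
  for stratified formulae, given as syntax trees. The predicate \<open>strat\<close> says that a predicate on
  environments is expressed by some stratified formula with parameters. It is closed under the
  connectives, the quantifiers and the set-theoretic operations in use, and the closure rules are
  directed by the shape of the predicate. So each existence claim is settled by backward
  chaining with these rules, and unification finds the levels.

  Second, Quine pairs are ordered pairs only if the successor is injective on the Frege naturals, and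
  that is the axiom of infinity. It is not among the axioms but a theorem of NF (Specker). The proof
  below is Specker's argument, reduced to the finite case. Suppose that the universe \<open>V\<close> is finite.
  Let \<open>X\<close> depend on \<open>T A\<close> whenever \<open>X\<close> is equinumerous with \<open>P A\<close>, so that passing from \<open>X\<close> to a set
  on which it depends amounts to \<open>|X| = 2^|T A| \<mapsto> |T A|\<close>, a step to a smaller cardinal. This relation
  is well-founded, so exactly one set \<open>K\<close> satisfies \<open>X \<in> K\<close> iff no set on which \<open>X\<close> depends is in \<open>K\<close>:
  membership in \<open>K\<close> is the parity of the number of times that the logarithm can be taken. The operation
  \<open>T\<close> commutes with the dependence, so by uniqueness \<open>X \<in> K\<close> iff \<open>T X \<in> K\<close>. But \<open>P V = V\<close>, so that \<open>V\<close>
  depends on \<open>T V\<close> and, by finiteness, on nothing else up to size; hence \<open>V \<in> K\<close> iff \<open>T V \<notin> K\<close>, a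
  contradiction. Pairs are not available for this part, so equinumerosity of finite sets is
  defined as membership in a common Frege natural, and everything is proved by induction.
\<close>

section \<open>Stratified predicates\<close>

text \<open>
  A context is a list of variable names, innermost binder first; \<open>look\<close> turns an assignment into the
  environment that a predicate sees, with de Bruijn indices. Indices outside the context get one fixed
  value, so that a predicate depends on the variables of its context only.
\<close>

definition look :: "(nat \<Rightarrow> 'v) \<Rightarrow> nat list \<Rightarrow> nat \<Rightarrow> 'v" where
  "look s xs i = (if i < length xs then s (xs ! i) else undefined)"

lemma look_0 [simp]: "look s (x # xs) 0 = s x"
  and look_Suc [simp]: "look s (x # xs) (Suc i) = look s xs i"
  by (simp_all add: look_def)

lemma look_tail [simp]: "(\<lambda>i. look s (x # xs) (Suc i)) = look s xs"
  by (simp add: fun_eq_iff)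

lemma look_upd [simp]: "x \<notin> set xs \<Longrightarrow> look (s(x := a)) xs = look s xs"
  by (auto simp: look_def fun_eq_iff)

text \<open>
  Enough names at every level for a fresh one to be found whenever a formula needs a bound variable
  or a parameter.
\<close>

definition rich :: "(nat \<Rightarrow> nat) \<Rightarrow> bool" where
  "rich l \<longleftrightarrow> (\<forall>k. infinite {x. l x = k})"

text \<open>
  The variables in \<open>F\<close> hold the parameters, with values \<open>g\<close>. They can be kept away from any finite
  set \<open>A\<close> of names, which is what allows two formulae to be combined without a clash. Distinct
  occurrences of one parameter may use distinct variables; a parameter therefore has no fixed level.
\<close>

definition definable :: "(nat \<Rightarrow> nat) \<Rightarrow> nat list \<Rightarrow> nat set \<Rightarrow> ((nat \<Rightarrow> 'v::nf) \<Rightarrow> bool) \<Rightarrow> bool" where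
  "definable l xs A P \<longleftrightarrow> (\<exists>p F g. stratified_by l p \<and> finite F \<and> F \<inter> (A \<union> set xs) = {} \<and>
     (\<forall>s. (\<forall>x\<in>F. s x = g x) \<longrightarrow> (sat (\<in>\<^sub>N) p s \<longleftrightarrow> P (look s xs))))"

text \<open>
  \<open>L\<close> lists the levels of the de Bruijn variables. Quantifying over all labellings and all names is
  what makes the closure rules free of renaming side conditions.
\<close>

definition strat :: "nat list \<Rightarrow> ((nat \<Rightarrow> 'v::nf) \<Rightarrow> bool) \<Rightarrow> bool" where
  "strat L P \<longleftrightarrow> (\<forall>l xs A. rich l \<and> map l xs = L \<and> finite A \<longrightarrow> definable l xs A P)"

definition strat_tm :: "nat list \<Rightarrow> nat \<Rightarrow> ((nat \<Rightarrow> 'v::nf) \<Rightarrow> 'v) \<Rightarrow> bool" where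
  "strat_tm L k t \<longleftrightarrow> strat (k # L) (\<lambda>c. c 0 = t (\<lambda>i. c (Suc i)))"

lemma definableI:
  assumes "stratified_by l p" "finite F" "F \<inter> (A \<union> set xs) = {}"
    and "\<And>s. \<forall>x\<in>F. s x = g x \<Longrightarrow> sat (\<in>\<^sub>N) p s \<longleftrightarrow> P (look s xs)"
  shows "definable l xs A P"
  unfolding definable_def using assms by blast

lemma stratI:
  assumes "\<And>l xs A. rich l \<Longrightarrow> map l xs = L \<Longrightarrow> finite A \<Longrightarrow> definable l xs A P"
  shows "strat L P"
  unfolding strat_def using assms by blast

lemma stratD:
  assumes "strat L P" "rich l" "map l xs = L" "finite A"
  shows "definable l xs A P"
  using assms unfolding strat_def by blast

lemma stratE:
  assumes "strat L P" "rich l" "map l xs = L" "finite A"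
  obtains p F g where "stratified_by l p" "finite F" "F \<inter> (A \<union> set xs) = {}"
    "\<forall>s. (\<forall>x\<in>F. s x = g x) \<longrightarrow> (sat (\<in>\<^sub>N) p s \<longleftrightarrow> P (look s xs))"
  using stratD[OF assms] unfolding definable_def using that by blast

lemma definable_cong:
  assumes "definable l xs A P" "\<And>s. P (look s xs) \<longleftrightarrow> Q (look s xs)"
  shows "definable l xs A Q"
  using assms(1) unfolding definable_def assms(2) .

lemma rich_fresh:
  assumes "rich l" "finite A"
  obtains x where "l x = k" "x \<notin> A"
proof -
  have "\<not> {x. l x = k} \<subseteq> A"
    using assms finite_subset unfolding rich_def by blast
  then show ?thesis using that by blast
qed

lemma strat_truth: "strat L (\<lambda>c :: nat \<Rightarrow> 'v::nf. b)"
proof (rule stratI)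
  fix l :: "nat \<Rightarrow> nat" and xs and A :: "nat set"
  show "definable l xs A (\<lambda>c :: nat \<Rightarrow> 'v. b)"
    by (rule definableI[of l "if b then Eq 0 0 else Neg (Eq 0 0)" "{}"]) simp_all
qed

lemma strat_not: assumes "strat L P" shows "strat L (\<lambda>c. \<not> P c)"
proof (rule stratI)
  fix l xs A assume *: "rich l" "map l xs = L" "finite (A::nat set)"
  obtain p F g where p: "stratified_by l p" "finite F" "F \<inter> (A \<union> set xs) = {}"
    "\<forall>s. (\<forall>x\<in>F. s x = g x) \<longrightarrow> (sat (\<in>\<^sub>N) p s \<longleftrightarrow> P (look s xs))"
    by (rule stratE[OF assms *])
  show "definable l xs A (\<lambda>c. \<not> P c)"
    by (rule definableI[of l "Neg p" F _ _ g]) (use p in simp_all)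
qed

lemma strat_conj: assumes "strat L P" "strat L Q" shows "strat L (\<lambda>c. P c \<and> Q c)"
proof (rule stratI)
  fix l xs A assume *: "rich l" "map l xs = L" "finite (A::nat set)"
  obtain p F g where p: "stratified_by l p" "finite F" "F \<inter> (A \<union> set xs) = {}"
    "\<forall>s. (\<forall>x\<in>F. s x = g x) \<longrightarrow> (sat (\<in>\<^sub>N) p s \<longleftrightarrow> P (look s xs))"
    by (rule stratE[OF assms(1) *])
  have AF: "finite (A \<union> F)" using *(3) p(2) by simp
  obtain q G h where q: "stratified_by l q" "finite G" "G \<inter> (A \<union> F \<union> set xs) = {}"
    "\<forall>s. (\<forall>x\<in>G. s x = h x) \<longrightarrow> (sat (\<in>\<^sub>N) q s \<longleftrightarrow> Q (look s xs))"
    by (rule stratE[OF assms(2) *(1,2) AF])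
  show "definable l xs A (\<lambda>c. P c \<and> Q c)"
  proof (rule definableI[of l "Conj p q" "F \<union> G" _ _ "\<lambda>x. if x \<in> F then g x else h x"])
    show "stratified_by l (Conj p q)" "finite (F \<union> G)" using p(1,2) q(1,2) by simp_all
    show "(F \<union> G) \<inter> (A \<union> set xs) = {}" using p(3) q(3) by blast
    fix s assume s: "\<forall>x\<in>F \<union> G. s x = (if x \<in> F then g x else h x)"
    then have "\<forall>x\<in>F. s x = g x" by simp
    moreover have "\<forall>x\<in>G. s x = h x" using s q(3) by fastforce
    ultimately show "sat (\<in>\<^sub>N) (Conj p q) s \<longleftrightarrow> P (look s xs) \<and> Q (look s xs)"
      by (simp add: p(4)[rule_format] q(4)[rule_format])
  qed
qed

lemma strat_all:
  assumes "strat (k # L) (\<lambda>c. P (c 0) (\<lambda>i. c (Suc i)))"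
  shows "strat L (\<lambda>c. \<forall>y. P y c)"
proof (rule stratI)
  fix l xs A assume *: "rich l" "map l xs = L" "finite (A::nat set)"
  obtain x where x: "l x = k" "x \<notin> A \<union> set xs" using * rich_fresh[of l "A \<union> set xs" k] by auto
  have xL: "map l (x # xs) = k # L" using x * by simp
  obtain p F g where p: "stratified_by l p" "finite F" "F \<inter> (A \<union> set (x # xs)) = {}"
    "\<forall>s. (\<forall>z\<in>F. s z = g z) \<longrightarrow> (sat (\<in>\<^sub>N) p s \<longleftrightarrow> P (look s (x # xs) 0) (\<lambda>i. look s (x # xs) (Suc i)))"
    by (rule stratE[OF assms *(1) xL *(3)])
  show "definable l xs A (\<lambda>c. \<forall>y. P y c)"
  proof (rule definableI[of l "All x p" F _ _ g])
    show "stratified_by l (All x p)" "finite F" "F \<inter> (A \<union> set xs) = {}" using p(1-3) by auto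
    fix s assume s: "\<forall>z\<in>F. s z = g z"
    have "sat (\<in>\<^sub>N) p (s(x := a)) \<longleftrightarrow> P a (look s xs)" for a
    proof -
      have "\<forall>z\<in>F. (s(x := a)) z = g z" using s p(3) by auto
      then show ?thesis using p(4)[rule_format, of "s(x := a)"] x by simp
    qed
    then show "sat (\<in>\<^sub>N) (All x p) s \<longleftrightarrow> (\<forall>y. P y (look s xs))" by simp
  qed
qed

lemma strat_atom_eq:
  assumes "i < length L" "j < length L" "L ! i = L ! j"
  shows "strat L (\<lambda>c :: nat \<Rightarrow> 'v::nf. c i = c j)"
proof (rule stratI)
  fix l :: "nat \<Rightarrow> nat" and xs and A :: "nat set" assume "map l xs = L"
  with assms show "definable l xs A (\<lambda>c :: nat \<Rightarrow> 'v. c i = c j)"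
    by (intro definableI[of l "Eq (xs ! i) (xs ! j)" "{}"]) (auto simp: look_def)
qed

lemma strat_atom_mem:
  assumes "i < length L" "j < length L" "L ! j = Suc (L ! i)"
  shows "strat L (\<lambda>c :: nat \<Rightarrow> 'v::nf. c i \<in>\<^sub>N c j)"
proof (rule stratI)
  fix l :: "nat \<Rightarrow> nat" and xs and A :: "nat set" assume "map l xs = L"
  with assms show "definable l xs A (\<lambda>c :: nat \<Rightarrow> 'v. c i \<in>\<^sub>N c j)"
    by (intro definableI[of l "Mem (xs ! i) (xs ! j)" "{}"]) (auto simp: look_def)
qed

text \<open>
  A parameter may be used at any level, since a fresh variable of the required level can hold it.
\<close>

lemma tm_const: "strat_tm L k (\<lambda>c. a)"
  unfolding strat_tm_def
proof (rule stratI)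
  fix l xs A assume *: "rich l" "map l xs = k # L" "finite (A::nat set)"
  then obtain y ys where xs: "xs = y # ys" "l y = k" by auto
  obtain x where x: "l x = k" "x \<notin> A \<union> set xs" using * rich_fresh[of l "A \<union> set xs" k] by auto
  then show "definable l xs A (\<lambda>c. c 0 = a)"
    using xs by (intro definableI[of l "Eq y x" "{x}" _ _ "\<lambda>_. a"]) auto
qed

text \<open>
  The extra variable has to be added to the names that parameters avoid: the formula for the smaller
  context knows nothing of it and could use its name for a parameter.
\<close>

lemma strat_weaken_0:
  assumes "strat L P"
  shows "strat (k # L) (\<lambda>c. P (\<lambda>i. c (Suc i)))"
proof (rule stratI)
  fix l xs A assume *: "rich l" "map l xs = k # L" "finite (A::nat set)"
  then obtain x ys where xs: "xs = x # ys" "map l ys = L" by auto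
  have Ax: "finite (A \<union> {x})" using * by simp
  obtain p F g where p: "stratified_by l p" "finite F" "F \<inter> (A \<union> {x} \<union> set ys) = {}"
    "\<forall>s. (\<forall>z\<in>F. s z = g z) \<longrightarrow> (sat (\<in>\<^sub>N) p s \<longleftrightarrow> P (look s ys))"
    by (rule stratE[OF assms *(1) xs(2) Ax])
  show "definable l xs A (\<lambda>c. P (\<lambda>i. c (Suc i)))"
  proof (rule definableI[of l p F _ _ g])
    show "stratified_by l p" "finite F" "F \<inter> (A \<union> set xs) = {}" using p(1-3) xs(1) by auto
    fix s assume "\<forall>z\<in>F. s z = g z"
    then show "sat (\<in>\<^sub>N) p s \<longleftrightarrow> P (\<lambda>i. look s xs (Suc i))" by (simp add: xs(1) p(4)[rule_format])
  qed
qed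

lemma strat_weaken_1:
  assumes "strat (k # L) (\<lambda>c. P (c 0) (\<lambda>i. c (Suc i)))"
  shows "strat (k # k' # L) (\<lambda>c. P (c 0) (\<lambda>i. c (Suc (Suc i))))"
proof (rule stratI)
  fix l xs A assume *: "rich l" "map l xs = k # k' # L" "finite (A::nat set)"
  then obtain y x ys where xs: "xs = y # x # ys" "map l (y # ys) = k # L" by auto
  have Ax: "finite (A \<union> {x})" using * by simp
  obtain p F g where p: "stratified_by l p" "finite F" "F \<inter> (A \<union> {x} \<union> set (y # ys)) = {}"
    "\<forall>s. (\<forall>z\<in>F. s z = g z) \<longrightarrow> (sat (\<in>\<^sub>N) p s \<longleftrightarrow> P (look s (y # ys) 0) (\<lambda>i. look s (y # ys) (Suc i)))"
    by (rule stratE[OF assms *(1) xs(2) Ax])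
  show "definable l xs A (\<lambda>c. P (c 0) (\<lambda>i. c (Suc (Suc i))))"
  proof (rule definableI[of l p F _ _ g])
    show "stratified_by l p" "finite F" "F \<inter> (A \<union> set xs) = {}" using p(1-3) xs(1) by auto
    fix s assume "\<forall>z\<in>F. s z = g z"
    then show "sat (\<in>\<^sub>N) p s \<longleftrightarrow> P (look s xs 0) (\<lambda>i. look s xs (Suc (Suc i)))"
      by (simp add: xs(1) p(4)[rule_format])
  qed
qed

lemma tm_weaken: "strat_tm L k t \<Longrightarrow> strat_tm (k' # L) k (\<lambda>c. t (\<lambda>i. c (Suc i)))"
  unfolding strat_tm_def by (rule strat_weaken_1)

lemma tm_var_0: "strat_tm (k # L) k (\<lambda>c. c 0)"
  unfolding strat_tm_def by (rule strat_atom_eq) auto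

lemma tm_var_Suc:
  assumes "strat_tm L k (\<lambda>c :: nat \<Rightarrow> 'v::nf. c n)"
  shows "strat_tm (k' # L) k (\<lambda>c :: nat \<Rightarrow> 'v. c (Suc n))"
  using tm_weaken[OF assms] .

lemma strat_disj: assumes "strat L P" "strat L Q" shows "strat L (\<lambda>c. P c \<or> Q c)"
  using strat_not[OF strat_conj[OF strat_not[OF assms(1)] strat_not[OF assms(2)]]]
  unfolding de_Morgan_conj not_not .

lemma strat_imp: assumes "strat L P" "strat L Q" shows "strat L (\<lambda>c. P c \<longrightarrow> Q c)"
  using strat_disj[OF strat_not[OF assms(1)] assms(2)] unfolding imp_conv_disj .

lemma strat_iff: assumes "strat L P" "strat L Q" shows "strat L (\<lambda>c. P c \<longleftrightarrow> Q c)"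
  using strat_conj[OF strat_imp[OF assms] strat_imp[OF assms(2,1)]]
  by (rule back_subst[of "strat L"]) (rule ext, blast)

lemma strat_ex:
  assumes "strat (k # L) (\<lambda>c. P (c 0) (\<lambda>i. c (Suc i)))"
  shows "strat L (\<lambda>c. \<exists>y. P y c)"
  using strat_not[OF strat_all[of k L "\<lambda>y c. \<not> P y c", OF strat_not[OF assms]]] by simp

lemma strat_ex1:
  assumes "strat (k # L) (\<lambda>c. P (c 0) (\<lambda>i. c (Suc i)))"
  shows "strat L (\<lambda>c. \<exists>!y. P y c)"
proof -
  have "strat (k # k # L) (\<lambda>c. P (c 0) (\<lambda>i. c (Suc (Suc i))) \<longleftrightarrow> c 0 = c (Suc 0))"
    by (rule strat_iff[OF strat_weaken_1[OF assms] strat_atom_eq]) auto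
  then have "strat L (\<lambda>c. \<exists>x. \<forall>y. P y c \<longleftrightarrow> y = x)"
    by (rule strat_ex[OF strat_all])
  moreover have "(\<exists>x. \<forall>y. P y c \<longleftrightarrow> y = x) \<longleftrightarrow> (\<exists>!y. P y c)" for c
    by (auto simp: Ex1_def)
  ultimately show ?thesis by simp
qed

lemma strat_eq:
  assumes "strat_tm L k a" "strat_tm L k b" shows "strat L (\<lambda>c. a c = b c)"
proof -
  have "strat L (\<lambda>c. \<exists>y. y = a c \<and> y = b c)"
    by (rule strat_ex[OF strat_conj[OF assms[unfolded strat_tm_def]]])
  then show ?thesis by simp
qed

lemma strat_mem:
  assumes "strat_tm L k a" "strat_tm L (Suc k) b" shows "strat L (\<lambda>c. a c \<in>\<^sub>N b c)"
proof -
  have "strat (Suc k # k # L) (\<lambda>c. c (Suc 0) \<in>\<^sub>N c 0)" by (rule strat_atom_mem) auto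
  then have "strat (Suc k # k # L) (\<lambda>c. c 0 = b (\<lambda>i. c (Suc (Suc i))) \<and> c (Suc 0) \<in>\<^sub>N c 0)"
    using strat_conj[OF tm_weaken[OF assms(2), unfolded strat_tm_def]] by blast
  then have "strat (k # L) (\<lambda>c. \<exists>z. z = b (\<lambda>i. c (Suc i)) \<and> c 0 \<in>\<^sub>N z)"
    by (rule strat_ex)
  from strat_conj[OF assms(1)[unfolded strat_tm_def] this]
  have "strat L (\<lambda>c. \<exists>y. y = a c \<and> (\<exists>z. z = b c \<and> y \<in>\<^sub>N z))"
    by (rule strat_ex)
  then show ?thesis by simp
qed

text \<open>
  In the comprehension axiom the collected variable is number 0, so the labelling is chosen to give
  that variable level \<open>k\<close>, to spread \<open>L\<close> over the next variables, and to leave infinitely many variables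
  at each level beyond.
\<close>

lemma comprehension_env:
  assumes "strat (k # L) (\<lambda>c. P (c 0) (\<lambda>i. c (Suc i)))" and ys: "length ys = length L"
  shows "\<exists>y. \<forall>x. x \<in>\<^sub>N y \<longleftrightarrow> P x (look s ys)"
proof -
  define l :: "nat \<Rightarrow> nat" where
    "l n = (if n = 0 then k else if n \<le> length L then L ! (n - 1) else fst (prod_decode n))" for n
  define xs where "xs = [1..<Suc (length L)]"
  have rich: "rich l"
    unfolding rich_def
  proof (intro allI notI)
    fix j assume "finite {x. l x = j}"
    then have "finite ({x. l x = j} \<union> {..length L})" by simp
    moreover have "range (\<lambda>i. prod_encode (j, i)) \<subseteq> {x. l x = j} \<union> {..length L}"
      by (auto simp: l_def)
    ultimately have "finite (range (\<lambda>i. prod_encode (j, i)))" using finite_subset by blast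
    moreover have "inj (\<lambda>i. prod_encode (j, i))" by (simp add: inj_def)
    ultimately show False using finite_imageD by blast
  qed
  have xL: "map l (0 # xs) = k # L"
    unfolding xs_def l_def by (auto intro!: nth_equalityI simp: nth_append simp del: upt_Suc)
  obtain p F g where p: "stratified_by l p" "finite F" "F \<inter> ({} \<union> set (0 # xs)) = {}"
    "\<forall>s. (\<forall>z\<in>F. s z = g z) \<longrightarrow> (sat (\<in>\<^sub>N) p s \<longleftrightarrow> P (look s (0 # xs) 0) (\<lambda>i. look s (0 # xs) (Suc i)))"
    by (rule stratE[OF assms(1) rich xL finite.emptyI])
  define r where "r n = (if n \<in> F then g n else s (ys ! (n - 1)))" for n
  obtain y where y: "\<And>x. x \<in>\<^sub>N y \<longleftrightarrow> sat (\<in>\<^sub>N) p (r(0 := x))"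
    using comprehension[of p r] p(1) unfolding stratifiable_def by blast
  have "look (r(0 := x)) xs = look s ys" for x
  proof
    fix i
    have "Suc i \<notin> F" if "i < length L" using p(3) that unfolding xs_def by (auto simp del: upt_Suc)
    then show "look (r(0 := x)) xs i = look s ys i"
      using ys unfolding look_def xs_def r_def by (simp del: upt_Suc)
  qed
  moreover have "\<forall>z\<in>F. (r(0 := x)) z = g z" for x using p(3) by (auto simp: r_def)
  ultimately have "x \<in>\<^sub>N y \<longleftrightarrow> P x (look s ys)" for x
    using y p(4) by simp
  then show ?thesis by blast
qed

definition setlike :: "('v::nf \<Rightarrow> bool) \<Rightarrow> bool" where
  "setlike P \<longleftrightarrow> (\<exists>y. \<forall>x. x \<in>\<^sub>N y \<longleftrightarrow> P x)"

lemma setlikeI: "strat [k] (\<lambda>c. P (c 0)) \<Longrightarrow> setlike P"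
  using comprehension_env[of k "[]" "\<lambda>x _. P x" "[]"] unfolding setlike_def by simp

lemma coll_eq: assumes "\<And>x. x \<in>\<^sub>N y \<longleftrightarrow> P x" shows "coll P = y"
  unfolding coll_def
proof (rule the_equality)
  show "\<forall>x. x \<in>\<^sub>N y \<longleftrightarrow> P x" using assms by blast
  fix z assume "\<forall>x. x \<in>\<^sub>N z \<longleftrightarrow> P x"
  then show "z = y" using assms by (intro extensionality) blast
qed

lemma mem_coll: assumes "setlike P" shows "x \<in>\<^sub>N coll P \<longleftrightarrow> P x"
proof -
  obtain y where y: "\<And>x. x \<in>\<^sub>N y \<longleftrightarrow> P x" using assms unfolding setlike_def by blast
  then show ?thesis by (simp add: coll_eq[OF y])
qed

lemma mem_coll_strat: "strat [k] (\<lambda>c. P (c 0)) \<Longrightarrow> x \<in>\<^sub>N coll P \<longleftrightarrow> P x"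
  by (rule mem_coll[OF setlikeI])

text \<open>
  That \<open>z\<close> is the set collecting \<open>P\<close> is expressed by the formula saying that \<open>z\<close> and \<open>P\<close> have the same
  elements; the two agree because the collection exists for every value of the parameters.
\<close>

lemma tm_coll:
  assumes "strat (k # L) (\<lambda>c. P (c 0) (\<lambda>i. c (Suc i)))"
  shows "strat_tm L (Suc k) (\<lambda>c. COLL y. P y c)"
  unfolding strat_tm_def
proof (rule stratI)
  fix l xs A assume *: "rich l" "map l xs = Suc k # L" "finite (A::nat set)"
  have "strat (k # Suc k # L) (\<lambda>c. c 0 \<in>\<^sub>N c (Suc 0) \<longleftrightarrow> P (c 0) (\<lambda>i. c (Suc (Suc i))))"
    by (rule strat_iff[OF strat_atom_mem strat_weaken_1[OF assms]]) simp_all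
  then have "strat (Suc k # L) (\<lambda>c. \<forall>y. y \<in>\<^sub>N c 0 \<longleftrightarrow> P y (\<lambda>i. c (Suc i)))"
    by (rule strat_all)
  note ** = stratD[OF this *]
  obtain x ys where xs: "xs = x # ys" "length ys = length L"
    using *(2) by auto
  show "definable l xs A (\<lambda>c. c 0 = (COLL y. P y (\<lambda>i. c (Suc i))))"
  proof (rule definable_cong[OF **])
    fix s
    have "setlike (\<lambda>y. P y (look s ys))"
      unfolding setlike_def by (rule comprehension_env[OF assms xs(2)])
    note m = mem_coll[OF this]
    have "s x = (COLL y. P y (look s ys))" if "\<forall>y. y \<in>\<^sub>N s x \<longleftrightarrow> P y (look s ys)"
      by (rule extensionality) (simp only: m that)
    with m have "(\<forall>y. y \<in>\<^sub>N s x \<longleftrightarrow> P y (look s ys)) \<longleftrightarrow> s x = (COLL y. P y (look s ys))"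
      by metis
    then show "(\<forall>y. y \<in>\<^sub>N look s xs 0 \<longleftrightarrow> P y (\<lambda>i. look s xs (Suc i))) \<longleftrightarrow>
        look s xs 0 = (COLL y. P y (\<lambda>i. look s xs (Suc i)))"
      unfolding xs(1) look_0 look_tail .
  qed
qed

lemma tm_if:
  assumes "strat L P" "strat_tm L k a" "strat_tm L k b"
  shows "strat_tm L k (\<lambda>c. if P c then a c else b c)"
proof -
  note P = strat_weaken_0[OF assms(1), of k]
  have "strat (k # L) (\<lambda>c. (P (\<lambda>i. c (Suc i)) \<longrightarrow> c 0 = a (\<lambda>i. c (Suc i))) \<and>
    (\<not> P (\<lambda>i. c (Suc i)) \<longrightarrow> c 0 = b (\<lambda>i. c (Suc i))))"
    by (rule strat_conj[OF strat_imp[OF P assms(2)[unfolded strat_tm_def]]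
          strat_imp[OF strat_not[OF P] assms(3)[unfolded strat_tm_def]]])
  then show ?thesis unfolding strat_tm_def
    by (rule back_subst[of "strat (k # L)"]) (rule ext, simp)
qed

text \<open>
  Which rule applies is decided by the outermost symbol, so \<open>rule strat_intros\<close>, repeated, proves a
  stratified predicate to be a set; levels are left as unknowns and solved on the way. Terms
  and formulae without bound variables count as parameters, whatever their shape.
\<close>

named_theorems strat_intros

lemmas basic_strat_intros [strat_intros] =
  strat_truth tm_const strat_not strat_conj strat_disj strat_imp strat_iff
  strat_all strat_ex strat_ex1 strat_eq strat_mem tm_var_0 tm_var_Suc tm_coll tm_if

section \<open>Elementary sets\<close>

lemma mem_empty [simp]: "\<not> x \<in>\<^sub>N empty"
  by (simp add: empty_def mem_coll_strat[where P = "\<lambda>_. False", OF strat_truth])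

lemma mem_sing [simp]: "x \<in>\<^sub>N sing a \<longleftrightarrow> x = a"
  unfolding sing_def by (rule mem_coll_strat, (rule strat_intros)+)

lemma mem_adjoin [simp]: "x \<in>\<^sub>N adjoin A a \<longleftrightarrow> x \<in>\<^sub>N A \<or> x = a"
  unfolding adjoin_def by (rule mem_coll_strat, (rule strat_intros)+)

lemma mem_T [simp]: "z \<in>\<^sub>N T X \<longleftrightarrow> (\<exists>x. x \<in>\<^sub>N X \<and> z = sing x)"
  unfolding T_def sing_def by (rule mem_coll_strat, (rule strat_intros)+)

lemma tm_sing [strat_intros]:
  assumes "strat_tm L k a"
  shows "strat_tm L (Suc k) (\<lambda>c. sing (a c))"
  unfolding sing_def
  by (rule strat_intros tm_weaken[OF assms])+

lemma tm_adjoin [strat_intros]: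
  assumes "strat_tm L (Suc k) A" "strat_tm L k a"
  shows "strat_tm L (Suc k) (\<lambda>c. adjoin (A c) (a c))"
  unfolding adjoin_def
  by (rule strat_intros tm_weaken[OF assms(1)] tm_weaken[OF assms(2)])+

lemma tm_T [strat_intros]:
  assumes "strat_tm L (Suc k) A"
  shows "strat_tm L (Suc (Suc k)) (\<lambda>c. T (A c))"
  unfolding T_def
  by (rule strat_intros tm_weaken[OF tm_weaken[OF assms]])+

lemma sing_inject [simp]: "sing a = sing b \<longleftrightarrow> a = b"
  by (metis mem_sing)

lemma adjoin_absorb: "a \<in>\<^sub>N A \<Longrightarrow> adjoin A a = A"
  by (rule extensionality) auto

definition subset :: "'v::nf \<Rightarrow> 'v \<Rightarrow> bool" (infix \<open>\<subseteq>\<^sub>N\<close> 50) where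
  "A \<subseteq>\<^sub>N B \<longleftrightarrow> (\<forall>x. x \<in>\<^sub>N A \<longrightarrow> x \<in>\<^sub>N B)"

definition univ :: "'v::nf" where "univ = (COLL x. True)"
definition remove :: "'v::nf \<Rightarrow> 'v \<Rightarrow> 'v" where "remove A a = (COLL x. x \<in>\<^sub>N A \<and> x \<noteq> a)"
definition union :: "'v::nf \<Rightarrow> 'v \<Rightarrow> 'v" where "union A B = (COLL x. x \<in>\<^sub>N A \<or> x \<in>\<^sub>N B)"
definition pow :: "'v::nf \<Rightarrow> 'v" where "pow A = (COLL X. X \<subseteq>\<^sub>N A)"
definition adjoins :: "'v::nf \<Rightarrow> 'v \<Rightarrow> 'v" where
  "adjoins D a = (COLL Z. \<exists>X. X \<in>\<^sub>N D \<and> Z = adjoin X a)"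

lemma strat_subset [strat_intros]:
  assumes "strat_tm L (Suc k) A" "strat_tm L (Suc k) B"
  shows "strat L (\<lambda>c. A c \<subseteq>\<^sub>N B c)"
  unfolding subset_def
  by (rule strat_intros tm_weaken[OF assms(1)] tm_weaken[OF assms(2)])+

lemma mem_univ [simp]: "x \<in>\<^sub>N univ"
  by (simp add: univ_def mem_coll_strat[where P = "\<lambda>_. True", OF strat_truth])
lemma mem_remove [simp]: "x \<in>\<^sub>N remove A a \<longleftrightarrow> x \<in>\<^sub>N A \<and> x \<noteq> a"
  unfolding remove_def by (rule mem_coll_strat, (rule strat_intros)+)
lemma mem_union [simp]: "x \<in>\<^sub>N union A B \<longleftrightarrow> x \<in>\<^sub>N A \<or> x \<in>\<^sub>N B"
  unfolding union_def by (rule mem_coll_strat, (rule strat_intros)+)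
lemma mem_pow [simp]: "x \<in>\<^sub>N pow A \<longleftrightarrow> x \<subseteq>\<^sub>N A"
  unfolding pow_def by (rule mem_coll_strat, (rule strat_intros)+)
lemma mem_adjoins [simp]: "Z \<in>\<^sub>N adjoins D a \<longleftrightarrow> (\<exists>X. X \<in>\<^sub>N D \<and> Z = adjoin X a)"
  unfolding adjoins_def by (rule mem_coll_strat, (rule strat_intros)+)

lemma tm_remove [strat_intros]:
  assumes "strat_tm L (Suc k) A" "strat_tm L k a"
  shows "strat_tm L (Suc k) (\<lambda>c. remove (A c) (a c))"
  unfolding remove_def
  by (rule strat_intros tm_weaken[OF assms(1)] tm_weaken[OF assms(2)])+

lemma tm_union [strat_intros]:
  assumes "strat_tm L (Suc k) A" "strat_tm L (Suc k) B"
  shows "strat_tm L (Suc k) (\<lambda>c. union (A c) (B c))"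
  unfolding union_def
  by (rule strat_intros tm_weaken[OF assms(1)] tm_weaken[OF assms(2)])+

lemma tm_pow [strat_intros]:
  assumes "strat_tm L (Suc k) A"
  shows "strat_tm L (Suc (Suc k)) (\<lambda>c. pow (A c))"
  unfolding pow_def
  by (rule strat_intros tm_weaken[OF assms])+

lemma subset_antisym: "A \<subseteq>\<^sub>N B \<Longrightarrow> B \<subseteq>\<^sub>N A \<Longrightarrow> A = B"
  unfolding subset_def by (rule extensionality) blast
lemma subset_refl [simp]: "A \<subseteq>\<^sub>N A" by (simp add: subset_def)
lemma subset_trans: "A \<subseteq>\<^sub>N B \<Longrightarrow> B \<subseteq>\<^sub>N C \<Longrightarrow> A \<subseteq>\<^sub>N C" by (simp add: subset_def)
lemma subset_empty: "A \<subseteq>\<^sub>N empty \<longleftrightarrow> A = empty"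
  using extensionality[of A empty] by (auto simp: subset_def)

section \<open>Frege naturals\<close>

lemma mem_succ [simp]: "z \<in>\<^sub>N succ n \<longleftrightarrow> (\<exists>A a. A \<in>\<^sub>N n \<and> \<not> a \<in>\<^sub>N A \<and> z = adjoin A a)"
  unfolding succ_def by (rule mem_coll_strat, (rule strat_intros)+)

lemma tm_succ [strat_intros]:
  assumes "strat_tm L (Suc (Suc k)) n"
  shows "strat_tm L (Suc (Suc k)) (\<lambda>c. succ (n c))"
  unfolding succ_def
  by (rule strat_intros tm_weaken[OF tm_weaken[OF tm_weaken[OF assms]]])+

lemma mem_nats: "n \<in>\<^sub>N nats \<longleftrightarrow> (\<forall>X. zero \<in>\<^sub>N X \<and> (\<forall>k. k \<in>\<^sub>N X \<longrightarrow> succ k \<in>\<^sub>N X) \<longrightarrow> n \<in>\<^sub>N X)"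
  unfolding nats_def by (rule mem_coll_strat, (rule strat_intros)+)

lemma zero_nat [simp]: "zero \<in>\<^sub>N nats" by (simp add: mem_nats)
lemma succ_nat [simp]: "n \<in>\<^sub>N nats \<Longrightarrow> succ n \<in>\<^sub>N nats" by (simp add: mem_nats)

lemma nat_induct_nf [consumes 1, case_names setlike zero succ]:
  assumes "n \<in>\<^sub>N nats" "setlike P" "P zero" "\<And>n. n \<in>\<^sub>N nats \<Longrightarrow> P n \<Longrightarrow> P (succ n)"
  shows "P n"
proof -
  obtain X where X: "\<And>x. x \<in>\<^sub>N X \<longleftrightarrow> P x" using assms(2) unfolding setlike_def by blast
  have "setlike (\<lambda>x. x \<in>\<^sub>N nats \<and> x \<in>\<^sub>N X)" by (rule setlikeI, (rule strat_intros)+)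
  then obtain Y where Y: "\<And>x. x \<in>\<^sub>N Y \<longleftrightarrow> x \<in>\<^sub>N nats \<and> P x" unfolding setlike_def X by blast
  have "n \<in>\<^sub>N Y" using assms(1)[unfolded mem_nats, rule_format, of Y] assms(3,4) by (simp add: Y)
  then show ?thesis by (simp add: Y)
qed

lemma mem_zero [simp]: "A \<in>\<^sub>N zero \<longleftrightarrow> A = empty" by (simp add: zero_def)

lemma adjoin_remove: "a \<in>\<^sub>N A \<Longrightarrow> adjoin (remove A a) a = A"
  by (rule extensionality) auto
lemma remove_adjoin: "\<not> a \<in>\<^sub>N A \<Longrightarrow> remove (adjoin A a) a = A"
  by (rule extensionality) auto
lemma remove_adjoin_ne: "a \<noteq> b \<Longrightarrow> remove (adjoin A b) a = adjoin (remove A a) b"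
  by (rule extensionality) auto
lemma adjoin_not_empty [simp]: "adjoin A a \<noteq> empty"
  by (metis mem_adjoin mem_empty)

text \<open>
  Any element can be removed, not just the one adjoined last: by induction, remove the element
  before the last one is adjoined again.
\<close>

lemma nat_remove:
  assumes "n \<in>\<^sub>N nats" "A \<in>\<^sub>N succ n" "a \<in>\<^sub>N A"
  shows "remove A a \<in>\<^sub>N n"
proof -
  have "\<forall>A a. A \<in>\<^sub>N succ n \<longrightarrow> a \<in>\<^sub>N A \<longrightarrow> remove A a \<in>\<^sub>N n"
    using assms(1)
  proof (induction rule: nat_induct_nf)
    case setlike
    show ?case by (rule setlikeI, (rule strat_intros)+)
  next
    case zero
    show ?case by (auto simp: remove_adjoin)
  next
    case (succ n)
    show ?case
    proof (intro allI impI)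
      fix A a assume "A \<in>\<^sub>N succ (succ n)" "a \<in>\<^sub>N A"
      then obtain B b where B: "B \<in>\<^sub>N succ n" "\<not> b \<in>\<^sub>N B" "A = adjoin B b" "a \<in>\<^sub>N adjoin B b"
        unfolding mem_succ[of _ "succ n"] by blast
      show "remove A a \<in>\<^sub>N succ n"
      proof (cases "a = b")
        case True then show ?thesis using B by (simp add: remove_adjoin del: mem_succ)
      next
        case False
        then have "remove B a \<in>\<^sub>N n" using succ.IH B by (simp del: mem_succ)
        then have "adjoin (remove B a) b \<in>\<^sub>N succ n"
          unfolding mem_succ using B(2) mem_remove by blast
        then show ?thesis using False B(3) by (simp add: remove_adjoin_ne del: mem_succ)
      qed
    qed
  qed
  then show ?thesis using assms by blast
qed

lemma nat_cases: "n \<in>\<^sub>N nats \<Longrightarrow> n = zero \<or> (\<exists>m. m \<in>\<^sub>N nats \<and> n = succ m)"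
proof (induction rule: nat_induct_nf)
  case setlike show ?case by (rule setlikeI, (rule strat_intros)+)
qed blast+

text \<open>
  Strip one element from the common set and use the induction hypothesis.
\<close>

lemma nat_disjoint:
  assumes "m \<in>\<^sub>N nats" "n \<in>\<^sub>N nats" "A \<in>\<^sub>N m" "A \<in>\<^sub>N n"
  shows "m = n"
proof -
  have "\<forall>n A. n \<in>\<^sub>N nats \<longrightarrow> A \<in>\<^sub>N m \<longrightarrow> A \<in>\<^sub>N n \<longrightarrow> m = n"
    using assms(1)
  proof (induction rule: nat_induct_nf)
    case setlike
    show ?case by (rule setlikeI, (rule strat_intros)+)
  next
    case zero
    show ?case by (metis mem_zero nat_cases adjoin_not_empty mem_succ)
  next
    case (succ m)
    show ?case
    proof (intro allI impI)
      fix n A assume *: "n \<in>\<^sub>N nats" "A \<in>\<^sub>N succ m" "A \<in>\<^sub>N n"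
      from *(2) obtain a where a: "a \<in>\<^sub>N A" unfolding mem_succ using mem_adjoin by metis
      then have "n \<noteq> zero" using *(3) by auto
      then obtain k where k: "k \<in>\<^sub>N nats" "n = succ k" using nat_cases *(1) by blast
      have "remove A a \<in>\<^sub>N m" "remove A a \<in>\<^sub>N k" using nat_remove a * k succ.hyps by blast+
      then show "succ m = n" using succ.IH k by blast
    qed
  qed
  then show ?thesis using assms by blast
qed

section \<open>Finite sets\<close>

definition finite_nf :: "'v::nf \<Rightarrow> bool" where
  "finite_nf X \<longleftrightarrow> (\<forall>S. empty \<in>\<^sub>N S \<and> (\<forall>A a. A \<in>\<^sub>N S \<longrightarrow> adjoin A a \<in>\<^sub>N S) \<longrightarrow> X \<in>\<^sub>N S)"

lemma setlike_finite: "setlike (finite_nf :: 'v::nf \<Rightarrow> bool)"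
  unfolding finite_nf_def[abs_def] by (rule setlikeI, (rule strat_intros)+)

lemma finite_empty: "finite_nf empty" by (simp add: finite_nf_def)
lemma finite_adjoin: "finite_nf A \<Longrightarrow> finite_nf (adjoin A a)" by (simp add: finite_nf_def)

lemma finite_nf_induct [consumes 1, case_names setlike empty adjoin]:
  fixes X :: "'v::nf"
  assumes "finite_nf X" "setlike P" "P empty"
    and adjoin: "\<And>A a. finite_nf A \<Longrightarrow> P A \<Longrightarrow> \<not> a \<in>\<^sub>N A \<Longrightarrow> P (adjoin A a)"
  shows "P X"
proof -
  obtain S F :: 'v where S: "\<And>x. x \<in>\<^sub>N S \<longleftrightarrow> P x" and F: "\<And>x. x \<in>\<^sub>N F \<longleftrightarrow> finite_nf x"
    using assms(2) setlike_finite unfolding setlike_def by metis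
  have "setlike (\<lambda>x. x \<in>\<^sub>N F \<and> x \<in>\<^sub>N S)" by (rule setlikeI, (rule strat_intros)+)
  then obtain R where R: "\<And>x. x \<in>\<^sub>N R \<longleftrightarrow> finite_nf x \<and> P x" unfolding setlike_def S F by blast
  have "P (adjoin A a)" if "finite_nf A" "P A" for A a
    using that adjoin adjoin_absorb by metis
  then have "X \<in>\<^sub>N R"
    using assms(1)[unfolded finite_nf_def, rule_format, of R] assms(3) finite_empty finite_adjoin R by blast
  then show ?thesis by (simp add: R)
qed

lemma finite_nat_member:
  fixes A :: "'v::nf"
  assumes "n \<in>\<^sub>N nats" "A \<in>\<^sub>N n" shows "finite_nf A"
proof -
  obtain F :: 'v where F: "\<And>x. x \<in>\<^sub>N F \<longleftrightarrow> finite_nf x" using setlike_finite unfolding setlike_def by blast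
  have "\<forall>A. A \<in>\<^sub>N n \<longrightarrow> A \<in>\<^sub>N F" using assms(1)
  proof (induction rule: nat_induct_nf)
    case setlike
    show ?case by (rule setlikeI, (rule strat_intros)+)
  qed (auto simp: F finite_empty finite_adjoin)
  then show ?thesis using assms F by blast
qed

lemma subset_adjoin: "B \<subseteq>\<^sub>N adjoin A a \<longleftrightarrow> (if a \<in>\<^sub>N B then remove B a \<subseteq>\<^sub>N A else B \<subseteq>\<^sub>N A)"
  by (auto simp: subset_def)

lemma finite_subset:
  fixes A :: "'v::nf"
  assumes "finite_nf A" "B \<subseteq>\<^sub>N A" shows "finite_nf B"
proof -
  obtain F :: 'v where F: "\<And>x. x \<in>\<^sub>N F \<longleftrightarrow> finite_nf x" using setlike_finite unfolding setlike_def by blast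
  have "\<forall>B. B \<subseteq>\<^sub>N A \<longrightarrow> B \<in>\<^sub>N F" using assms(1)
  proof (induction rule: finite_nf_induct)
    case setlike
    show ?case by (rule setlikeI, (rule strat_intros)+)
  next
    case empty then show ?case by (simp add: subset_empty F finite_empty)
  next
    case (adjoin A a)
    show ?case
    proof (intro allI impI)
      fix B assume B: "B \<subseteq>\<^sub>N adjoin A a"
      show "B \<in>\<^sub>N F"
      proof (cases "a \<in>\<^sub>N B")
        case True
        then have "remove B a \<in>\<^sub>N F" using B adjoin.IH by (simp add: subset_adjoin)
        then show ?thesis using finite_adjoin[of "remove B a" a] True by (simp add: F adjoin_remove)
      qed (use B adjoin.IH in \<open>simp add: subset_adjoin\<close>)
    qed
  qed
  then show ?thesis using assms F by blast
qed

lemma finite_in_nat: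
  assumes "finite_nf A" shows "\<exists>n. n \<in>\<^sub>N nats \<and> A \<in>\<^sub>N n"
  using assms
proof (induction rule: finite_nf_induct)
  case setlike
  show ?case by (rule setlikeI, (rule strat_intros)+)
next
  case empty then show ?case using zero_nat mem_zero by blast
next
  case (adjoin A a) then show ?case by (metis succ_nat mem_succ)
qed

section \<open>Equinumerosity of finite sets\<close>

text \<open>
  Being in a common natural serves as equinumerosity. For sets that are not finite the relation is empty.
\<close>

definition equi :: "'v::nf \<Rightarrow> 'v \<Rightarrow> bool" (infix \<open>\<approx>\<close> 50) where
  "A \<approx> B \<longleftrightarrow> (\<exists>n. n \<in>\<^sub>N nats \<and> A \<in>\<^sub>N n \<and> B \<in>\<^sub>N n)"

lemma strat_equi [strat_intros]:
  assumes "strat_tm L (Suc k) a" "strat_tm L (Suc k) b" shows "strat L (\<lambda>c. a c \<approx> b c)"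
  unfolding equi_def
  by (rule strat_intros tm_weaken[OF assms(1)] tm_weaken[OF assms(2)])+

lemma equi_refl: "finite_nf A \<Longrightarrow> A \<approx> A"
  unfolding equi_def using finite_in_nat by blast
lemma equi_sym: "A \<approx> B \<Longrightarrow> B \<approx> A"
  unfolding equi_def by blast
lemma equi_trans: "A \<approx> B \<Longrightarrow> B \<approx> C \<Longrightarrow> A \<approx> C"
  unfolding equi_def using nat_disjoint by metis

lemma equi_finite: assumes "A \<approx> B" shows "finite_nf A" "finite_nf B"
  using assms finite_nat_member unfolding equi_def by auto

lemma equi_empty: "empty \<approx> empty" by (rule equi_refl[OF finite_empty])

lemma equi_adjoin:
  assumes "A \<approx> B" "\<not> a \<in>\<^sub>N A" "\<not> b \<in>\<^sub>N B" shows "adjoin A a \<approx> adjoin B b"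
proof -
  obtain n where n: "n \<in>\<^sub>N nats" "A \<in>\<^sub>N n" "B \<in>\<^sub>N n" using assms(1) unfolding equi_def by blast
  then have "adjoin A a \<in>\<^sub>N succ n" "adjoin B b \<in>\<^sub>N succ n" unfolding mem_succ using assms by blast+
  then show ?thesis using n succ_nat unfolding equi_def by blast
qed

text \<open>
  Replaces arguments by a bijection: both sets are built up simultaneously.
\<close>

lemma equi_induct [consumes 1, case_names setlike empty adjoin]:
  assumes "A \<approx> B" and set: "setlike (\<lambda>n. \<forall>A B. A \<in>\<^sub>N n \<longrightarrow> B \<in>\<^sub>N n \<longrightarrow> P A B)"
    and empty: "P empty empty"
    and adjoin: "\<And>A B a b. A \<approx> B \<Longrightarrow> P A B \<Longrightarrow> \<not> a \<in>\<^sub>N A \<Longrightarrow> \<not> b \<in>\<^sub>N B \<Longrightarrow> P (adjoin A a) (adjoin B b)"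
  shows "P A B"
proof -
  obtain n where n: "n \<in>\<^sub>N nats" "A \<in>\<^sub>N n" "B \<in>\<^sub>N n" using assms(1) unfolding equi_def by blast
  have "\<forall>A B. A \<in>\<^sub>N n \<longrightarrow> B \<in>\<^sub>N n \<longrightarrow> P A B"
    using n(1)
  proof (induction rule: nat_induct_nf)
    case setlike then show ?case by (rule set)
  next
    case zero then show ?case using empty by simp
  next
    case (succ n)
    show ?case
    proof (intro allI impI)
      fix A B assume "A \<in>\<^sub>N succ n" "B \<in>\<^sub>N succ n"
      then obtain A' a B' b where *: "A' \<in>\<^sub>N n" "\<not> a \<in>\<^sub>N A'" "A = adjoin A' a"
        "B' \<in>\<^sub>N n" "\<not> b \<in>\<^sub>N B'" "B = adjoin B' b" unfolding mem_succ by blast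
      then have "A' \<approx> B'" using succ.hyps unfolding equi_def by blast
      then show "P A B" using * succ.IH adjoin by blast
    qed
  qed
  then show ?thesis using n by blast
qed

lemma equi_empty_iff: "A \<approx> empty \<longleftrightarrow> A = empty"
proof
  assume "A \<approx> empty"
  then obtain n where n: "n \<in>\<^sub>N nats" "A \<in>\<^sub>N n" "empty \<in>\<^sub>N n" unfolding equi_def by blast
  then have "n = zero" using nat_disjoint[OF n(1) zero_nat] by simp
  then show "A = empty" using n by simp
qed (simp add: equi_empty)

lemma equi_remove:
  assumes "A \<approx> B" "a \<in>\<^sub>N A" "b \<in>\<^sub>N B" shows "remove A a \<approx> remove B b"
proof -
  obtain n where n: "n \<in>\<^sub>N nats" "A \<in>\<^sub>N n" "B \<in>\<^sub>N n" using assms(1) unfolding equi_def by blast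
  then have "n \<noteq> zero" using assms(2) by auto
  then obtain m where "m \<in>\<^sub>N nats" "n = succ m" using n nat_cases by blast
  then show ?thesis using n nat_remove assms unfolding equi_def by blast
qed

text \<open>
  Dedekind finiteness. If the last element \<open>a\<close> of the bigger set is missing from \<open>B\<close>, removing any \<open>b\<close>
  from \<open>B\<close> leaves a subset of \<open>A\<close> that is as large as \<open>A\<close>, so \<open>B - {b} = A\<close> by the induction
  hypothesis, although \<open>b \<in> A\<close>.
\<close>

lemma equi_subset_eq:
  assumes "A \<approx> B" "B \<subseteq>\<^sub>N A" shows "B = A"
proof -
  have "\<forall>B. B \<subseteq>\<^sub>N A \<longrightarrow> A \<approx> B \<longrightarrow> B = A"
    using equi_finite(1)[OF assms(1)]
  proof (induction rule: finite_nf_induct)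
    case setlike
    show ?case by (rule setlikeI, (rule strat_intros)+)
  next
    case empty then show ?case by (simp add: subset_empty)
  next
    case (adjoin A a)
    show ?case
    proof (intro allI impI)
      fix B assume B: "B \<subseteq>\<^sub>N adjoin A a" "adjoin A a \<approx> B"
      show "B = adjoin A a"
      proof (cases "a \<in>\<^sub>N B")
        case True
        then have "remove B a \<subseteq>\<^sub>N A" "A \<approx> remove B a"
          using B equi_remove[OF B(2), of a a] adjoin.hyps by (simp_all add: subset_adjoin remove_adjoin)
        then have "remove B a = A" using adjoin.IH by blast
        then show ?thesis using adjoin_remove[OF True] by simp
      next
        case False
        then have s: "B \<subseteq>\<^sub>N A" using B by (simp add: subset_adjoin)
        have "B \<noteq> empty" using B(2) by (auto simp: equi_empty_iff)
        then obtain b where b: "b \<in>\<^sub>N B" by (metis extensionality mem_empty)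
        have "A \<approx> remove B b" using equi_remove[OF B(2) _ b, of a] adjoin.hyps by (simp add: remove_adjoin)
        moreover have "remove B b \<subseteq>\<^sub>N A" using s by (simp add: subset_def)
        ultimately have "remove B b = A" using adjoin.IH by blast
        then show ?thesis using b s unfolding subset_def by (metis mem_remove)
      qed
    qed
  qed
  then show ?thesis using assms by blast
qed

lemma comparable:
  assumes "finite_nf A" "finite_nf B"
  shows "(\<exists>C. C \<subseteq>\<^sub>N B \<and> A \<approx> C) \<or> (\<exists>C. C \<subseteq>\<^sub>N A \<and> C \<approx> B)"
  using assms(1)
proof (induction rule: finite_nf_induct)
  case setlike
  show ?case by (rule setlikeI, (rule strat_intros)+)
next
  case empty
  have "empty \<subseteq>\<^sub>N B" by (simp add: subset_def)
  then show ?case using equi_empty by blast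
next
  case (adjoin A a)
  show ?case
  proof (cases "\<exists>C. C \<subseteq>\<^sub>N A \<and> C \<approx> B")
    case True
    then show ?thesis by (auto simp: subset_def)
  next
    case False
    then obtain C where C: "C \<subseteq>\<^sub>N B" "A \<approx> C" using adjoin.IH by blast
    have "C \<noteq> B" using False C by auto
    then obtain b where b: "b \<in>\<^sub>N B" "\<not> b \<in>\<^sub>N C" using C(1) extensionality unfolding subset_def by metis
    then have "adjoin C b \<subseteq>\<^sub>N B" using C by (auto simp: subset_def)
    then show ?thesis using equi_adjoin[OF C(2) adjoin.hyps(2) b(2)] by blast
  qed
qed

lemma T_adjoin: "T (adjoin A a) = adjoin (T A) (sing a)"
  by (rule extensionality) auto
lemma T_empty: "T empty = empty"
  by (rule extensionality) auto
lemma T_union: "T (union A B) = union (T A) (T B)"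
  by (rule extensionality) auto
lemma T_mono: "A \<subseteq>\<^sub>N B \<Longrightarrow> T A \<subseteq>\<^sub>N T B"
  by (auto simp: subset_def)
lemma T_inject: "T A = T B \<longleftrightarrow> A = B"
proof
  assume "T A = T B"
  then have "\<And>x. sing x \<in>\<^sub>N T A \<longleftrightarrow> sing x \<in>\<^sub>N T B" by simp
  then show "A = B" by (intro extensionality) simp
qed simp

lemma subset_T: assumes "W \<subseteq>\<^sub>N T B" shows "\<exists>A. A \<subseteq>\<^sub>N B \<and> W = T A"
proof -
  have "setlike (\<lambda>x. sing x \<in>\<^sub>N W)" by (rule setlikeI, (rule strat_intros)+)
  then obtain A where A: "\<And>x. x \<in>\<^sub>N A \<longleftrightarrow> sing x \<in>\<^sub>N W" unfolding setlike_def by blast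
  have "W = T A" using assms by (intro extensionality) (auto simp: A subset_def)
  moreover have "A \<subseteq>\<^sub>N B" using assms by (auto simp: A subset_def)
  ultimately show ?thesis by blast
qed

lemma equi_T: "A \<approx> B \<Longrightarrow> T A \<approx> T B"
proof (induction rule: equi_induct)
  case setlike
  show ?case by (rule setlikeI, (rule strat_intros)+)
next
  case empty show ?case by (simp add: T_empty equi_empty)
next
  case (adjoin A B a b) then show ?case by (simp add: T_adjoin equi_adjoin)
qed

lemma equi_union:
  assumes "X \<approx> X'" "Y \<approx> Y'" "\<And>z. z \<in>\<^sub>N X \<Longrightarrow> \<not> z \<in>\<^sub>N Y" "\<And>z. z \<in>\<^sub>N X' \<Longrightarrow> \<not> z \<in>\<^sub>N Y'"
  shows "union X Y \<approx> union X' Y'"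
proof -
  have "(\<forall>z. z \<in>\<^sub>N X \<longrightarrow> \<not> z \<in>\<^sub>N Y) \<longrightarrow> (\<forall>z. z \<in>\<^sub>N X' \<longrightarrow> \<not> z \<in>\<^sub>N Y') \<longrightarrow> union X Y \<approx> union X' Y'"
    using assms(2)
  proof (induction rule: equi_induct)
    case setlike
    show ?case by (rule setlikeI, (rule strat_intros)+)
  next
    case empty
    have "union Z empty = Z" for Z :: 'a by (rule extensionality) simp
    then show ?case using assms(1) by simp
  next
    case (adjoin A B a b)
    have "union Z (adjoin A a) = adjoin (union Z A) a" for Z A a :: 'a by (rule extensionality) auto
    then show ?case using adjoin by (auto intro!: equi_adjoin)
  qed
  then show ?thesis using assms(3,4) by blast
qed

lemma adjoin_inject: "\<not> a \<in>\<^sub>N X \<Longrightarrow> \<not> a \<in>\<^sub>N Y \<Longrightarrow> adjoin X a = adjoin Y a \<Longrightarrow> X = Y"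
  by (metis remove_adjoin)

lemma tm_adjoins [strat_intros]:
  assumes "strat_tm L (Suc (Suc k)) D" "strat_tm L k a"
  shows "strat_tm L (Suc (Suc k)) (\<lambda>c. adjoins (D c) (a c))"
  unfolding adjoins_def
  by (rule strat_intros tm_weaken[OF tm_weaken[OF assms(1)]] tm_weaken[OF tm_weaken[OF assms(2)]])+

text \<open>
  Used with \<open>D\<close> the power set of \<open>A\<close>, for \<open>a \<notin> A\<close>: the subsets of \<open>A \<union> {a}\<close> that contain \<open>a\<close> are as many as
  those that do not.
\<close>

lemma equi_adjoins:
  assumes "finite_nf D" "\<And>X. X \<in>\<^sub>N D \<Longrightarrow> \<not> a \<in>\<^sub>N X"
  shows "adjoins D a \<approx> D"
proof -
  have "(\<forall>X. X \<in>\<^sub>N D \<longrightarrow> \<not> a \<in>\<^sub>N X) \<longrightarrow> adjoins D a \<approx> D"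
    using assms(1)
  proof (induction rule: finite_nf_induct)
    case setlike
    show ?case by (rule setlikeI, (rule strat_intros)+)
  next
    case empty
    have "adjoins empty a = empty" by (rule extensionality) simp
    then show ?case using equi_empty by simp
  next
    case (adjoin D Y)
    show ?case
    proof
      assume *: "\<forall>X. X \<in>\<^sub>N adjoin D Y \<longrightarrow> \<not> a \<in>\<^sub>N X"
      have "adjoins (adjoin D Y) a = adjoin (adjoins D a) (adjoin Y a)"
        by (rule extensionality) auto
      moreover have "\<not> adjoin Y a \<in>\<^sub>N adjoins D a"
      proof
        assume "adjoin Y a \<in>\<^sub>N adjoins D a"
        then obtain X where "X \<in>\<^sub>N D" "adjoin Y a = adjoin X a" by auto
        then show False using * adjoin.hyps(2) adjoin_inject[of a Y X] by auto
      qed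
      moreover have "adjoins D a \<approx> D" using * adjoin.IH by simp
      ultimately show "adjoins (adjoin D Y) a \<approx> adjoin D Y"
        using equi_adjoin[of "adjoins D a" D "adjoin Y a" Y] adjoin.hyps(2) by simp
    qed
  qed
  then show ?thesis using assms(2) by blast
qed

lemma pow_empty: "pow empty = adjoin empty empty"
  by (rule extensionality) (simp add: subset_empty)

lemma pow_adjoin: "pow (adjoin A a) = union (pow A) (adjoins (pow A) a)"
proof (rule extensionality)
  fix B
  have "\<exists>X. X \<subseteq>\<^sub>N A \<and> B = adjoin X a" if "B \<subseteq>\<^sub>N adjoin A a" "\<not> B \<subseteq>\<^sub>N A"
  proof (intro exI conjI)
    have a: "a \<in>\<^sub>N B" using that by (auto simp: subset_adjoin split: if_splits)
    show "remove B a \<subseteq>\<^sub>N A" using that(1) a by (simp add: subset_adjoin)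
    show "B = adjoin (remove B a) a" using a by (simp add: adjoin_remove)
  qed
  moreover have "B \<subseteq>\<^sub>N adjoin A a" if "B \<subseteq>\<^sub>N A" using that by (simp add: subset_def)
  moreover have "adjoin X a \<subseteq>\<^sub>N adjoin A a" if "X \<subseteq>\<^sub>N A" for X using that by (simp add: subset_def)
  ultimately show "B \<in>\<^sub>N pow (adjoin A a) \<longleftrightarrow> B \<in>\<^sub>N union (pow A) (adjoins (pow A) a)"
    unfolding mem_pow mem_union mem_adjoins by blast
qed

lemma finite_pow: "finite_nf A \<Longrightarrow> finite_nf (pow A)"
proof (induction rule: finite_nf_induct)
  case setlike
  show ?case unfolding finite_nf_def by (rule setlikeI, (rule strat_intros)+)
next
  case empty show ?case by (simp add: pow_empty finite_empty finite_adjoin)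
next
  case (adjoin A a)
  have "\<And>X. X \<in>\<^sub>N pow A \<Longrightarrow> \<not> a \<in>\<^sub>N X" using adjoin.hyps by (auto simp: subset_def)
  note e = equi_adjoins[OF adjoin.IH this]
  have "\<And>z. z \<in>\<^sub>N pow A \<Longrightarrow> \<not> z \<in>\<^sub>N adjoins (pow A) a" using adjoin.hyps by (auto simp: subset_def)
  then have "union (pow A) (adjoins (pow A) a) \<approx> union (pow A) (adjoins (pow A) a)"
    using e equi_union[OF equi_refl[OF adjoin.IH] equi_refl[OF equi_finite(1)[OF e]]] by blast
  then show ?case unfolding pow_adjoin by (rule equi_finite)
qed

text \<open>
  The induction step that doubles a power set.
\<close>

lemma equi_pow_step:
  assumes "P \<approx> Q" "\<And>X. X \<in>\<^sub>N P \<Longrightarrow> \<not> a \<in>\<^sub>N X" "\<And>X. X \<in>\<^sub>N Q \<Longrightarrow> \<not> b \<in>\<^sub>N X"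
  shows "union P (adjoins P a) \<approx> union Q (adjoins Q b)"
proof (rule equi_union[OF assms(1)])
  have "adjoins P a \<approx> P" using equi_finite(1)[OF assms(1)] assms(2) by (rule equi_adjoins)
  moreover have "adjoins Q b \<approx> Q" using equi_finite(2)[OF assms(1)] assms(3) by (rule equi_adjoins)
  ultimately show "adjoins P a \<approx> adjoins Q b"
    using equi_trans[OF equi_trans[OF _ assms(1)] equi_sym] by simp
  show "\<not> z \<in>\<^sub>N adjoins P a" if "z \<in>\<^sub>N P" for z using assms(2)[OF that] by auto
  show "\<not> z \<in>\<^sub>N adjoins Q b" if "z \<in>\<^sub>N Q" for z using assms(3)[OF that] by auto
qed

lemma equi_pow: "A \<approx> B \<Longrightarrow> pow A \<approx> pow B"
proof (induction rule: equi_induct)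
  case setlike
  show ?case by (rule setlikeI, (rule strat_intros)+)
next
  case empty show ?case by (intro equi_refl finite_pow finite_empty)
next
  case (adjoin A B a b)
  show ?case unfolding pow_adjoin
    by (rule equi_pow_step[OF adjoin.IH]) (use adjoin.hyps in \<open>auto simp: subset_def\<close>)
qed

text \<open>
  The map \<open>{X} \<mapsto> T X\<close> is the obvious bijection; without functions at hand, both sides are seen to
  double when an element is adjoined to \<open>B\<close>.
\<close>

lemma pow_T_equi: "finite_nf B \<Longrightarrow> pow (T B) \<approx> T (pow B)"
proof (induction rule: finite_nf_induct)
  case setlike
  show ?case by (rule setlikeI, (rule strat_intros)+)
next
  case empty
  show ?case by (simp add: T_empty pow_empty T_adjoin equi_adjoin equi_empty)
next
  case (adjoin B b)
  have b: "\<not> b \<in>\<^sub>N X" if "X \<in>\<^sub>N pow B" for X using that adjoin.hyps by (auto simp: subset_def)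
  have Tb: "\<not> sing b \<in>\<^sub>N X" if "X \<in>\<^sub>N pow (T B)" for X using that adjoin.hyps by (auto simp: subset_def)
  have fin: "finite_nf (pow (T B))" using adjoin.IH by (rule equi_finite)
  have "finite_nf (pow B)" using adjoin.hyps finite_pow by blast
  then have "T (pow B) \<approx> T (adjoins (pow B) b)" using b by (intro equi_T equi_sym[OF equi_adjoins])
  then have "adjoins (pow (T B)) (sing b) \<approx> T (adjoins (pow B) b)"
    using equi_adjoins[OF fin Tb] adjoin.IH equi_trans by blast
  then show ?case unfolding pow_adjoin T_adjoin T_union
    by (intro equi_union[OF adjoin.IH]) (use adjoin.hyps in \<open>auto simp: subset_def\<close>)
qed

section \<open>The universe is infinite\<close>

text \<open>
  The defining condition, at \<open>X\<close>, of the set \<open>K\<close> of those \<open>X\<close> whose rank under the dependence of \<open>P A\<close> on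
  \<open>T A\<close> is even. In game terms \<open>K\<close> is the kernel of the dependence graph.
\<close>

definition kernel_at :: "'v::nf \<Rightarrow> 'v \<Rightarrow> bool" where
  "kernel_at K X \<longleftrightarrow> (X \<in>\<^sub>N K \<longleftrightarrow> (\<forall>A. X \<approx> pow A \<longrightarrow> \<not> T A \<in>\<^sub>N K))"

lemma strat_kernel_at [strat_intros]:
  assumes "strat_tm L (Suc (Suc (Suc k))) K" "strat_tm L (Suc (Suc k)) X"
  shows "strat L (\<lambda>c. kernel_at (K c) (X c))"
  unfolding kernel_at_def
  by (rule strat_intros assms tm_weaken[OF assms(1)] tm_weaken[OF assms(2)])+

definition size_le :: "'v::nf \<Rightarrow> 'v \<Rightarrow> bool" where
  "size_le X Y \<longleftrightarrow> (\<exists>Z. Z \<subseteq>\<^sub>N Y \<and> X \<approx> Z)"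
definition size_less :: "'v::nf \<Rightarrow> 'v \<Rightarrow> bool" where
  "size_less X Y \<longleftrightarrow> (\<exists>Z. Z \<subseteq>\<^sub>N Y \<and> Z \<noteq> Y \<and> X \<approx> Z)"

lemma strat_size_le [strat_intros]:
  assumes "strat_tm L (Suc k) a" "strat_tm L (Suc k) b"
  shows "strat L (\<lambda>c. size_le (a c) (b c))"
  unfolding size_le_def
  by (rule strat_intros tm_weaken[OF assms(1)] tm_weaken[OF assms(2)])+

context
  assumes finite_univ: "finite_nf (univ :: 'v::nf)"
begin

lemma finite_all: "finite_nf (X :: 'v)"
  by (rule finite_subset[OF finite_univ]) (simp add: subset_def)

lemma equi_refl_all: "(X :: 'v) \<approx> X"
  by (rule equi_refl[OF finite_all])

text \<open>
  In place of the image of \<open>W\<close> under a bijection of \<open>X\<close> with \<open>Y\<close>: by comparability \<open>W\<close> is equinumerous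
  with part of \<open>Y\<close>, as otherwise \<open>Y\<close> would embed into \<open>W\<close>, which by finiteness forces \<open>W = X\<close>.
\<close>

lemma transfer_subset:
  fixes X Y W :: 'v
  assumes "X \<approx> Y" "W \<subseteq>\<^sub>N X"
  obtains W' where "W' \<subseteq>\<^sub>N Y" "W \<approx> W'" "W' = Y \<longrightarrow> W = X"
proof -
  have full: "W = X" if "W \<approx> Y"
    using equi_subset_eq[OF equi_trans[OF assms(1) equi_sym[OF that]] assms(2)] .
  consider C where "C \<subseteq>\<^sub>N Y" "W \<approx> C" | C where "C \<subseteq>\<^sub>N W" "C \<approx> Y"
    using comparable[OF finite_all finite_all, of Y W] by blast
  then show ?thesis
  proof cases
    case 1
    then show ?thesis using that full by blast
  next
    case 2
    have "C = X"
      using equi_subset_eq[OF equi_trans[OF assms(1) equi_sym[OF 2(2)]] subset_trans[OF 2(1) assms(2)]] .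
    then have "W = X" using 2(1) assms(2) subset_antisym by blast
    then show ?thesis using that[of Y] assms(1) by simp
  qed
qed

text \<open>
  If \<open>W\<close> contains \<open>a\<close>, trade \<open>a\<close> for an element of \<open>X\<close> that \<open>W\<close> omits.
\<close>

lemma proper_subset_adjoin:
  fixes X W :: 'v
  assumes "W \<subseteq>\<^sub>N adjoin X a" "W \<noteq> adjoin X a"
  shows "size_le W X"
proof (cases "a \<in>\<^sub>N W")
  case False
  then have "W \<subseteq>\<^sub>N X" using assms(1) by (simp add: subset_adjoin)
  then show ?thesis using equi_refl_all unfolding size_le_def by blast
next
  case True
  obtain x where x: "x \<in>\<^sub>N adjoin X a" "\<not> x \<in>\<^sub>N W"
    using assms subset_antisym unfolding subset_def by blast
  then have "x \<in>\<^sub>N X" using True by auto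
  have "adjoin (remove W a) a \<approx> adjoin (remove W a) x"
    using x(2) by (intro equi_adjoin equi_refl_all) auto
  then have "W \<approx> adjoin (remove W a) x" using adjoin_remove[OF True] by simp
  moreover have "adjoin (remove W a) x \<subseteq>\<^sub>N X"
    using \<open>x \<in>\<^sub>N X\<close> assms(1) by (auto simp: subset_def)
  ultimately show ?thesis unfolding size_le_def by blast
qed

lemma size_less_adjoin:
  fixes X Y Z :: 'v
  assumes "size_less Z Y" "size_le Y (adjoin X a)"
  shows "size_le Z X"
proof -
  obtain W where W: "W \<subseteq>\<^sub>N adjoin X a" "Y \<approx> W" using assms(2) unfolding size_le_def by blast
  obtain Z' where Z': "Z' \<subseteq>\<^sub>N Y" "Z' \<noteq> Y" "Z \<approx> Z'" using assms(1) unfolding size_less_def by blast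
  obtain Z'' where Z'': "Z'' \<subseteq>\<^sub>N W" "Z' \<approx> Z''" "Z'' \<noteq> W"
    using transfer_subset[OF W(2) Z'(1)] Z'(2) by metis
  have "Z'' \<subseteq>\<^sub>N adjoin X a" "Z'' \<noteq> adjoin X a"
    using Z''(1,3) W(1) subset_trans subset_antisym by blast+
  then have "size_le Z'' X" by (rule proper_subset_adjoin)
  then show ?thesis using equi_trans[OF Z'(3) Z''(2)] equi_trans unfolding size_le_def by blast
qed

lemma not_size_less_empty:
  assumes "size_less (Z :: 'v) Y" "size_le Y empty" shows False
proof -
  have Y: "Y = empty" using assms(2) unfolding size_le_def by (metis subset_empty equi_empty_iff)
  then show False using assms(1) unfolding size_less_def by (metis subset_empty)
qed

text \<open>
  Cantor's inequality is immediate here: the singletons of elements of \<open>A\<close> are subsets of \<open>A\<close>, and the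
  empty set is a further one.
\<close>

lemma T_size_less_pow: assumes "(X :: 'v) \<approx> pow A" shows "size_less (T A) X"
proof -
  have s: "T A \<subseteq>\<^sub>N pow A" by (auto simp: subset_def)
  have "empty \<in>\<^sub>N pow A" "\<not> empty \<in>\<^sub>N T A"
    by (simp add: subset_def) (metis mem_T mem_empty mem_sing)
  then have "T A \<noteq> pow A" by metis
  then show ?thesis using transfer_subset[OF equi_sym[OF assms] s] unfolding size_less_def by metis
qed

lemma size_induct [case_names setlike less]:
  fixes X :: 'v
  assumes "setlike P" and less: "\<And>X. (\<And>Y. size_less Y X \<Longrightarrow> P Y) \<Longrightarrow> P X"
  shows "P X"
proof -
  obtain S where S: "\<And>x. x \<in>\<^sub>N S \<longleftrightarrow> P x" using assms(1) unfolding setlike_def by blast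
  have "\<forall>Y. size_le Y X \<longrightarrow> Y \<in>\<^sub>N S"
    using finite_all[of X]
  proof (induction rule: finite_nf_induct)
    case setlike
    show ?case by (rule setlikeI, (rule strat_intros)+)
  next
    case empty
    then show ?case using not_size_less_empty less S by blast
  next
    case (adjoin A a)
    then show ?case using size_less_adjoin less S by blast
  qed
  moreover have "size_le X X" unfolding size_le_def using equi_refl_all subset_refl by blast
  ultimately show ?thesis using S by blast
qed

lemma kernel_unique:
  fixes X :: 'v
  assumes "\<And>X. kernel_at K X" "\<And>X. kernel_at K' X"
  shows "X \<in>\<^sub>N K \<longleftrightarrow> X \<in>\<^sub>N K'"
proof (induction X rule: size_induct)
  case setlike
  show ?case by (rule setlikeI, (rule strat_intros)+)
next
  case (less X)
  then have "T A \<in>\<^sub>N K \<longleftrightarrow> T A \<in>\<^sub>N K'" if "X \<approx> pow A" for A using T_size_less_pow[OF that] by blast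
  then show ?case using assms[of X] unfolding kernel_at_def by blast
qed

text \<open>
  The kernel is built up along the sizes. Passing from \<open>X\<close> to \<open>X \<union> {a}\<close>, membership is kept for sets of
  size at most \<open>|X|\<close> and read off from the defining condition for all others; the sets that this
  condition refers to are smaller.
\<close>

lemma kernel_exists: "\<exists>K :: 'v. \<forall>X. kernel_at K X"
proof -
  have "\<exists>K :: 'v. \<forall>Y. size_le Y univ \<longrightarrow> kernel_at K Y"
    using finite_univ
  proof (induction rule: finite_nf_induct)
    case setlike
    show ?case by (rule setlikeI, (rule strat_intros)+)
  next
    case empty
    \<comment> \<open>The empty set depends on nothing, hence must be a member; every set containing it will do.\<close>
    have "kernel_at univ Y" if "size_le Y empty" for Y :: 'v
      using not_size_less_empty[OF T_size_less_pow that] unfolding kernel_at_def by auto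
    then show ?case by blast
  next
    case (adjoin X a)
    then obtain K where K: "\<And>Y. size_le Y X \<Longrightarrow> kernel_at K Y" by blast
    \<comment> \<open>The sets of size at most that of \<open>X\<close> are settled by \<open>K\<close>, and all others by the condition.\<close>
    have "setlike (\<lambda>Y. if size_le Y X then Y \<in>\<^sub>N K else \<forall>A. Y \<approx> pow A \<longrightarrow> \<not> T A \<in>\<^sub>N K)"
      unfolding if_bool_eq_conj by (rule setlikeI, (rule strat_intros)+)
    then obtain K' where K': "\<And>Y. Y \<in>\<^sub>N K' \<longleftrightarrow> 
      (if size_le Y X then Y \<in>\<^sub>N K else \<forall>A. Y \<approx> pow A \<longrightarrow> \<not> T A \<in>\<^sub>N K)"
      unfolding setlike_def by blast
    have "kernel_at K' Y" if Y: "size_le Y (adjoin X a)" for Y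
    proof -
      have "T A \<in>\<^sub>N K' \<longleftrightarrow> T A \<in>\<^sub>N K" if "Y \<approx> pow A" for A
        using size_less_adjoin[OF T_size_less_pow[OF that] Y] K' by simp
      moreover have "Y \<in>\<^sub>N K' \<longleftrightarrow> (\<forall>A. Y \<approx> pow A \<longrightarrow> \<not> T A \<in>\<^sub>N K)"
        using K' K[of Y] unfolding kernel_at_def by simp
      ultimately show ?thesis unfolding kernel_at_def by blast
    qed
    then show ?case by blast
  qed
  moreover have "size_le Y univ" for Y :: 'v
    unfolding size_le_def using equi_refl_all by (auto simp: subset_def)
  ultimately show ?thesis by blast
qed

lemma equi_T_cancel:
  assumes "T A \<approx> T (B :: 'v)" shows "A \<approx> B"
proof -
  have *: "X = Y" if "X \<subseteq>\<^sub>N Y" "T X \<approx> T Y" for X Y :: 'v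
    using equi_subset_eq[OF equi_sym[OF that(2)] T_mono[OF that(1)]] by (simp add: T_inject)
  consider C where "C \<subseteq>\<^sub>N B" "A \<approx> C" | C where "C \<subseteq>\<^sub>N A" "C \<approx> B"
    using comparable[OF finite_all finite_all, of B A] by blast
  then show ?thesis
  proof cases
    case 1
    have "T C \<approx> T B" using equi_trans[OF equi_sym[OF equi_T[OF 1(2)]] assms] .
    then have "C = B" by (rule *[OF 1(1)])
    then show ?thesis using 1 by simp
  next
    case 2
    have "T C \<approx> T A" using equi_trans[OF equi_T[OF 2(2)] equi_sym[OF assms]] .
    then have "C = A" by (rule *[OF 2(1)])
    then show ?thesis using 2 by simp
  qed
qed

lemma pow_univ: "pow (univ :: 'v) = univ"
  by (rule extensionality) (simp add: subset_def)

lemma pow_subset_cancel: "pow W = pow A \<Longrightarrow> W = (A :: 'v)"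
  using mem_pow subset_refl subset_antisym by metis

text \<open>
  If \<open>T X\<close> depends on \<open>T A\<close> then \<open>A\<close> is itself the size of some \<open>T B\<close>. Otherwise \<open>A\<close> would have more elements
  than \<open>T V\<close>, and \<open>P A\<close> more than \<open>P (T V)\<close>, which is as large as \<open>T (P V) = T V\<close>; yet \<open>P A\<close> is the size
  of \<open>T X \<subseteq> T V\<close>.
\<close>

lemma T_equi_pow:
  assumes "T X \<approx> pow (A :: 'v)"
  obtains B where "A \<approx> T B" "X \<approx> pow B"
proof -
  have "\<exists>B. A \<approx> T B"
  proof -
    consider C where "C \<subseteq>\<^sub>N T univ" "A \<approx> C" | C where "C \<subseteq>\<^sub>N A" "C \<approx> T univ"
      using comparable[OF finite_all finite_all, of "T univ" A] by blast
    then show ?thesis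
    proof cases
      case 1
      then show ?thesis using subset_T by blast
    next
      case 2
      have "pow C \<approx> T univ"
        using equi_trans[OF equi_pow[OF 2(2)] pow_T_equi[OF finite_univ]] by (simp add: pow_univ)
      have "pow C \<subseteq>\<^sub>N pow A" using 2(1) by (auto simp: subset_def)
      then obtain W where W: "W \<subseteq>\<^sub>N T X" "pow C \<approx> W" "W = T X \<longrightarrow> pow C = pow A"
        using transfer_subset[OF equi_sym[OF assms]] by metis
      have "T X \<subseteq>\<^sub>N T univ" by (rule T_mono) (simp add: subset_def)
      moreover have "W = T univ"
        using equi_subset_eq[OF equi_trans[OF equi_sym[OF \<open>pow C \<approx> T univ\<close>] W(2)]]
          subset_trans[OF W(1) \<open>T X \<subseteq>\<^sub>N T univ\<close>] by blast
      ultimately have "W = T X" using W(1) subset_antisym by blast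
      then have "C = A" using W(3) pow_subset_cancel by blast
      then show ?thesis using 2(2) by blast
    qed
  qed
  then obtain B where B: "A \<approx> T B" by blast
  have "T X \<approx> T (pow B)"
    using equi_trans[OF equi_trans[OF assms equi_pow[OF B]] pow_T_equi[OF finite_all]] .
  then show ?thesis using that B equi_T_cancel by blast
qed

text \<open>
  The set \<open>K' = {X. T X \<in> K}\<close> is a kernel as well, so it equals \<open>K\<close>, whereas at the universe the kernel
  condition says that \<open>K\<close> and \<open>K'\<close> differ.
\<close>

lemma finite_univ_contradiction: False
proof -
  obtain K :: 'v where K: "\<And>X. kernel_at K X" using kernel_exists by blast
  have resp: "X \<in>\<^sub>N K \<longleftrightarrow> Y \<in>\<^sub>N K" if "X \<approx> Y" for X Y
  proof -
    have "X \<approx> Z \<longleftrightarrow> Y \<approx> Z" for Z using that equi_trans equi_sym by blast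
    then show ?thesis using K[of X] K[of Y] unfolding kernel_at_def by simp
  qed
  have "setlike (\<lambda>X. T X \<in>\<^sub>N K)" by (rule setlikeI, (rule strat_intros)+)
  then obtain K' where K': "\<And>X. X \<in>\<^sub>N K' \<longleftrightarrow> T X \<in>\<^sub>N K" unfolding setlike_def by blast
  have "kernel_at K' X" for X
  proof -
    have "(\<forall>A. T X \<approx> pow A \<longrightarrow> \<not> T A \<in>\<^sub>N K) \<longleftrightarrow> (\<forall>B. X \<approx> pow B \<longrightarrow> \<not> T (T B) \<in>\<^sub>N K)"
    proof (intro iffI allI impI)
      fix B assume *: "\<forall>A. T X \<approx> pow A \<longrightarrow> \<not> T A \<in>\<^sub>N K" "X \<approx> pow B"
      have "T X \<approx> pow (T B)"
        using equi_trans[OF equi_T[OF *(2)] equi_sym[OF pow_T_equi[OF finite_all]]] .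
      then show "\<not> T (T B) \<in>\<^sub>N K" using *(1) by blast
    next
      fix A assume *: "\<forall>B. X \<approx> pow B \<longrightarrow> \<not> T (T B) \<in>\<^sub>N K" "T X \<approx> pow A"
      obtain B where "A \<approx> T B" "X \<approx> pow B" by (rule T_equi_pow[OF *(2)])
      then show "\<not> T A \<in>\<^sub>N K" using *(1) resp[OF equi_T] by blast
    qed
    then show ?thesis using K[of "T X"] unfolding kernel_at_def K' by blast
  qed
  then have T_inv: "T X \<in>\<^sub>N K \<longleftrightarrow> X \<in>\<^sub>N K" for X using kernel_unique[OF K, of K'] K' by blast
  \<comment> \<open>A power set as large as the universe is all of it, so only \<open>T univ\<close> is depended on.\<close>
  have "A = univ" if "univ \<approx> pow A" for A :: 'v
  proof -
    have "pow A = univ" using equi_subset_eq[OF that] by (simp add: subset_def)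
    then show ?thesis using pow_univ pow_subset_cancel by metis
  qed
  then have "univ \<in>\<^sub>N K \<longleftrightarrow> \<not> T univ \<in>\<^sub>N K"
    using K[of univ] equi_refl_all[of univ] pow_univ unfolding kernel_at_def by metis
  then show False using T_inv by blast
qed

end

theorem univ_infinite: "\<not> finite_nf (univ :: 'v::nf)"
  using finite_univ_contradiction by blast

section \<open>Quine pairs\<close>

text \<open>
  This is where infinity enters: a set in a natural is never the universe, so an element can be
  adjoined to it.
\<close>

lemma nat_nonempty: "n \<in>\<^sub>N nats \<Longrightarrow> \<exists>A. A \<in>\<^sub>N n"
proof (induction rule: nat_induct_nf)
  case setlike
  show ?case by (rule setlikeI, (rule strat_intros)+)
next
  case zero show ?case by simp
next
  case (succ n)
  then obtain A where A: "A \<in>\<^sub>N n" by blast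
  then have "finite_nf A" using finite_nat_member succ.hyps by blast
  then have "A \<noteq> univ" using univ_infinite by blast
  then obtain a where "\<not> a \<in>\<^sub>N A" using extensionality mem_univ by metis
  then show ?case using A unfolding mem_succ by blast
qed

lemma succ_not_zero: "n \<in>\<^sub>N nats \<Longrightarrow> succ n \<noteq> zero"
  by (metis mem_succ mem_zero adjoin_not_empty nat_nonempty succ_nat)

lemma succ_inject:
  assumes "m \<in>\<^sub>N nats" "n \<in>\<^sub>N nats" "succ m = succ n" shows "m = n"
proof -
  obtain A where A: "A \<in>\<^sub>N succ m" using nat_nonempty[OF succ_nat[OF assms(1)]] by blast
  then obtain a where a: "a \<in>\<^sub>N A" unfolding mem_succ using mem_adjoin by metis
  have "A \<in>\<^sub>N succ n" using A assms(3) by simp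
  then show ?thesis using nat_disjoint[OF assms(1,2) nat_remove[OF assms(1) A a]] nat_remove[OF assms(2) _ a] by blast
qed

text \<open>
  The operation that \<open>shift\<close> applies to the elements of a set. It is injective and omits 0, so the
  presence of 0 tells the second component of a Quine pair from the first.
\<close>

definition bump :: "'v::nf \<Rightarrow> 'v" where
  "bump a = (if a \<in>\<^sub>N nats then succ a else a)"

lemma bump_inject: "bump a = bump b \<longleftrightarrow> a = b"
proof
  assume "bump a = bump b"
  then show "a = b" unfolding bump_def using succ_inject succ_nat by metis
qed simp

lemma bump_not_zero: "bump a \<noteq> zero"
  unfolding bump_def using succ_not_zero zero_nat by metis

lemma mem_shift [simp]: "z \<in>\<^sub>N shift A \<longleftrightarrow> (\<exists>a. a \<in>\<^sub>N A \<and> z = bump a)"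
  unfolding shift_def bump_def by (rule mem_coll_strat, (rule strat_intros)+)

lemma shift_inject: "shift A = shift B \<longleftrightarrow> A = B"
proof
  assume s: "shift A = shift B"
  have "x \<in>\<^sub>N X \<longleftrightarrow> bump x \<in>\<^sub>N shift X" for x X :: 'a
    by (simp add: bump_inject)
  then show "A = B" using s by (intro extensionality) metis
qed simp

lemma zero_notin_shift: "\<not> zero \<in>\<^sub>N shift A"
  by (simp add: bump_not_zero[symmetric])

lemma tm_shift [strat_intros]:
  assumes "strat_tm L (Suc (Suc (Suc k))) A"
  shows "strat_tm L (Suc (Suc (Suc k))) (\<lambda>c. shift (A c))"
  unfolding shift_def
  by (rule strat_intros tm_weaken[OF tm_weaken[OF assms]])+

lemma mem_pair: "z \<in>\<^sub>N \<langle>A, B\<rangle> \<longleftrightarrow>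
    (\<exists>a. a \<in>\<^sub>N A \<and> z = shift a) \<or> (\<exists>b. b \<in>\<^sub>N B \<and> z = adjoin (shift b) zero)"
  unfolding pair_def by (rule mem_coll_strat, (rule strat_intros)+)

text \<open>
  Pairing keeps the level. Four levels have to be available below it, because the elements of the
  elements of a component may be naturals, to which the successor, with its bound variables, is applied.
\<close>

lemma tm_pair [strat_intros]:
  assumes "strat_tm L (Suc (Suc (Suc (Suc k)))) A" "strat_tm L (Suc (Suc (Suc (Suc k)))) B"
  shows "strat_tm L (Suc (Suc (Suc (Suc k)))) (\<lambda>c. \<langle>A c, B c\<rangle>)"
  unfolding pair_def
  by (rule strat_intros tm_weaken[OF tm_weaken[OF assms(1)]] tm_weaken[OF tm_weaken[OF assms(2)]])+

lemma mem_pair_shift: "shift a \<in>\<^sub>N \<langle>A, B\<rangle> \<longleftrightarrow> a \<in>\<^sub>N A"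
  unfolding mem_pair shift_inject using zero_notin_shift[of a] by (metis mem_adjoin)

lemma mem_pair_shift_zero: "adjoin (shift b) zero \<in>\<^sub>N \<langle>A, B\<rangle> \<longleftrightarrow> b \<in>\<^sub>N B"
proof -
  have "adjoin (shift b) zero = adjoin (shift b') zero \<longleftrightarrow> b = b'" for b' :: 'a
    using adjoin_inject[OF zero_notin_shift zero_notin_shift] shift_inject by metis
  moreover have "adjoin (shift b) zero \<noteq> shift a" for a
    using zero_notin_shift[of a] by (metis mem_adjoin)
  ultimately show ?thesis unfolding mem_pair by auto
qed

lemma pair_inject [simp]: "\<langle>A, B\<rangle> = \<langle>A', B'\<rangle> \<longleftrightarrow> A = A' \<and> B = B'"
proof
  assume *: "\<langle>A, B\<rangle> = \<langle>A', B'\<rangle>"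
  have "A = A'" by (rule extensionality) (metis * mem_pair_shift)
  moreover have "B = B'" by (rule extensionality) (metis * mem_pair_shift_zero)
  ultimately show "A = A' \<and> B = B'" by blast
qed simp

section \<open>Functions and sizes\<close>

lemma setlike_cong: "setlike Q \<Longrightarrow> (\<And>x. P x \<longleftrightarrow> Q x) \<Longrightarrow> setlike P"
  unfolding setlike_def by simp

text \<open>
  Application by \<open>THE\<close> is not a stratified operation outside the domain of \<open>f\<close>. The union of all values
  of \<open>f\<close> at \<open>x\<close> is one everywhere, and it agrees with \<open>f \<cdot> x\<close> on the domain. Existence proofs
  replace the former by the latter.
\<close>

definition ap :: "'v::nf \<Rightarrow> 'v \<Rightarrow> 'v" where
  "ap f x = (COLL z. \<exists>y. \<langle>x, y\<rangle> \<in>\<^sub>N f \<and> z \<in>\<^sub>N y)"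

lemma tm_ap [strat_intros]:
  assumes "strat_tm L (Suc (Suc (Suc (Suc (Suc k))))) f" "strat_tm L (Suc (Suc (Suc (Suc k)))) x"
  shows "strat_tm L (Suc (Suc (Suc (Suc k)))) (\<lambda>c. ap (f c) (x c))"
  unfolding ap_def
  by (rule strat_intros tm_weaken[OF tm_weaken[OF assms(1)]] tm_weaken[OF tm_weaken[OF assms(2)]])+

lemma strat_is_fun [strat_intros]:
  assumes "strat_tm L (Suc (Suc (Suc (Suc (Suc k))))) f" "strat_tm L (Suc (Suc (Suc (Suc (Suc k))))) X"
    "strat_tm L (Suc (Suc (Suc (Suc (Suc k))))) Y"
  shows "strat L (\<lambda>c. is_fun (f c) (X c) (Y c))"
  unfolding is_fun_def
  by (rule strat_intros tm_weaken[OF assms(1)] tm_weaken[OF assms(2)]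
      tm_weaken[OF tm_weaken[OF assms(1)]] tm_weaken[OF tm_weaken[OF tm_weaken[OF assms(2)]]]
      tm_weaken[OF tm_weaken[OF tm_weaken[OF assms(3)]]])+

lemma pair_mem_fun:
  assumes "is_fun f X Y" "\<langle>x, y\<rangle> \<in>\<^sub>N f" shows "x \<in>\<^sub>N X" "y \<in>\<^sub>N Y"
proof -
  obtain x' y' where "x' \<in>\<^sub>N X" "y' \<in>\<^sub>N Y" "\<langle>x, y\<rangle> = \<langle>x', y'\<rangle>"
    using assms unfolding is_fun_def by blast
  then show "x \<in>\<^sub>N X" "y \<in>\<^sub>N Y" by simp_all
qed

lemma app_eq:
  assumes "is_fun f X Y" "\<langle>x, y\<rangle> \<in>\<^sub>N f" shows "f \<cdot> x = y"
proof -
  have "\<exists>!y. \<langle>x, y\<rangle> \<in>\<^sub>N f" using assms pair_mem_fun(1)[OF assms] unfolding is_fun_def by blast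
  then show ?thesis unfolding app_def using assms(2) by (rule the1_equality)
qed

lemma app_mem:
  assumes "is_fun f X Y" "x \<in>\<^sub>N X" shows "\<langle>x, f \<cdot> x\<rangle> \<in>\<^sub>N f" "f \<cdot> x \<in>\<^sub>N Y"
proof -
  obtain y where y: "\<langle>x, y\<rangle> \<in>\<^sub>N f" using assms unfolding is_fun_def by blast
  then show "\<langle>x, f \<cdot> x\<rangle> \<in>\<^sub>N f" "f \<cdot> x \<in>\<^sub>N Y"
    using app_eq[OF assms(1) y] pair_mem_fun(2)[OF assms(1) y] by simp_all
qed

lemma graph_iff:
  assumes "is_fun f X Y" shows "\<langle>x, y\<rangle> \<in>\<^sub>N f \<longleftrightarrow> x \<in>\<^sub>N X \<and> y = f \<cdot> x"
  using app_eq[OF assms] app_mem(1)[OF assms] pair_mem_fun(1)[OF assms] by blast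

lemma mem_fun_iff:
  assumes "is_fun f X Y" shows "p \<in>\<^sub>N f \<longleftrightarrow> (\<exists>x. x \<in>\<^sub>N X \<and> p = \<langle>x, f \<cdot> x\<rangle>)"
proof
  assume p: "p \<in>\<^sub>N f"
  obtain x y where xy: "p = \<langle>x, y\<rangle>"
    using conjunct1[OF assms[unfolded is_fun_def], rule_format, OF p] by blast
  have "x \<in>\<^sub>N X \<and> y = f \<cdot> x" using p unfolding xy graph_iff[OF assms] .
  then show "\<exists>x. x \<in>\<^sub>N X \<and> p = \<langle>x, f \<cdot> x\<rangle>" using xy by simp
next
  assume "\<exists>x. x \<in>\<^sub>N X \<and> p = \<langle>x, f \<cdot> x\<rangle>"
  then show "p \<in>\<^sub>N f" using app_mem(1)[OF assms] by auto
qed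

lemma ap_app: assumes "is_fun f X Y" "x \<in>\<^sub>N X" shows "ap f x = f \<cdot> x"
  unfolding ap_def by (rule coll_eq) (simp add: graph_iff[OF assms(1)] assms(2))

lemma fun_ext:
  assumes "is_fun f X Y" "is_fun g X Y'" "\<And>x. x \<in>\<^sub>N X \<Longrightarrow> f \<cdot> x = g \<cdot> x"
  shows "f = g"
proof (rule extensionality)
  show "p \<in>\<^sub>N f \<longleftrightarrow> p \<in>\<^sub>N g" for p
    unfolding mem_fun_iff[OF assms(1)] mem_fun_iff[OF assms(2)] using assms(3) by auto
qed

text \<open>
  Functions are built from their graphs: a functional relation that is a set is a function, with the
  values that the relation assigns.
\<close>

lemma is_fun_coll:
  assumes "setlike P"
    and "\<And>p. P p \<Longrightarrow> \<exists>x y. x \<in>\<^sub>N X \<and> y \<in>\<^sub>N Y \<and> p = \<langle>x, y\<rangle>"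
    and "\<And>x. x \<in>\<^sub>N X \<Longrightarrow> \<exists>!y. P \<langle>x, y\<rangle>"
  shows "is_fun (coll P) X Y" and "P \<langle>x, y\<rangle> \<Longrightarrow> coll P \<cdot> x = y"
proof -
  show f: "is_fun (coll P) X Y"
    unfolding is_fun_def mem_coll[OF assms(1)] using assms(2,3) by blast
  show "coll P \<cdot> x = y" if "P \<langle>x, y\<rangle>"
    by (rule app_eq[OF f]) (simp add: mem_coll[OF assms(1)] that)
qed

lemma function_from_rule:
  assumes "setlike (\<lambda>p. \<exists>x. x \<in>\<^sub>N X \<and> p = \<langle>x, g x\<rangle>)" "\<And>x. x \<in>\<^sub>N X \<Longrightarrow> g x \<in>\<^sub>N Y"
  obtains f where "is_fun f X Y" "\<forall>x. x \<in>\<^sub>N X \<longrightarrow> f \<cdot> x = g x"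
proof -
  have *: "\<exists>x y. x \<in>\<^sub>N X \<and> y \<in>\<^sub>N Y \<and> p = \<langle>x, y\<rangle>" if "\<exists>x. x \<in>\<^sub>N X \<and> p = \<langle>x, g x\<rangle>" for p
    using that assms(2) by blast
  have **: "\<exists>!y. \<exists>x'. x' \<in>\<^sub>N X \<and> \<langle>x, y\<rangle> = \<langle>x', g x'\<rangle>" if "x \<in>\<^sub>N X" for x
    using that by simp
  note f = is_fun_coll[OF assms(1) * **]
  have "coll (\<lambda>p. \<exists>x. x \<in>\<^sub>N X \<and> p = \<langle>x, g x\<rangle>) \<cdot> x = g x" if "x \<in>\<^sub>N X" for x
    by (rule f(2)) (use that in auto)
  then show ?thesis using that f(1) by blast
qed

lemma same_size_from_rule:
  assumes "setlike (\<lambda>p. \<exists>x. x \<in>\<^sub>N X \<and> p = \<langle>x, g x\<rangle>)" "\<And>x. x \<in>\<^sub>N X \<Longrightarrow> g x \<in>\<^sub>N Y"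
    and inj: "\<And>x x'. x \<in>\<^sub>N X \<Longrightarrow> x' \<in>\<^sub>N X \<Longrightarrow> g x = g x' \<Longrightarrow> x = x'"
    and surj: "\<And>y. y \<in>\<^sub>N Y \<Longrightarrow> \<exists>x. x \<in>\<^sub>N X \<and> g x = y"
  shows "X \<cong> Y"
proof -
  obtain f where f: "is_fun f X Y" "\<forall>x. x \<in>\<^sub>N X \<longrightarrow> f \<cdot> x = g x"
    by (rule function_from_rule[OF assms(1,2)])
  have "\<exists>!x. \<langle>x, y\<rangle> \<in>\<^sub>N f" if y: "y \<in>\<^sub>N Y" for y
    unfolding graph_iff[OF f(1)] using surj[OF y] inj f(2) by metis
  then show ?thesis unfolding same_size_def is_bij_def using f(1) by blast
qed

lemma same_sizeE:
  assumes "X \<cong> Y"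
  obtains f where "is_fun f X Y"
    "\<forall>x x'. x \<in>\<^sub>N X \<longrightarrow> x' \<in>\<^sub>N X \<longrightarrow> f \<cdot> x = f \<cdot> x' \<longrightarrow> x = x'"
    "\<forall>y. y \<in>\<^sub>N Y \<longrightarrow> (\<exists>x. x \<in>\<^sub>N X \<and> f \<cdot> x = y)"
proof -
  obtain f where f: "is_fun f X Y" "\<forall>y. y \<in>\<^sub>N Y \<longrightarrow> (\<exists>!x. \<langle>x, y\<rangle> \<in>\<^sub>N f)"
    using assms unfolding same_size_def is_bij_def by blast
  have "x = x'" if "x \<in>\<^sub>N X" "x' \<in>\<^sub>N X" "f \<cdot> x = f \<cdot> x'" for x x'
    using that app_mem[OF f(1)] f(2) by metis
  moreover have "\<exists>x. x \<in>\<^sub>N X \<and> f \<cdot> x = y" if "y \<in>\<^sub>N Y" for y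
    using that f(2) graph_iff[OF f(1)] by metis
  ultimately show ?thesis using that f(1) by blast
qed

lemma same_size_trans:
  assumes "X \<cong> Y" "Y \<cong> Z" shows "X \<cong> Z"
proof -
  obtain f where f: "is_fun f X Y"
    "\<forall>x x'. x \<in>\<^sub>N X \<longrightarrow> x' \<in>\<^sub>N X \<longrightarrow> f \<cdot> x = f \<cdot> x' \<longrightarrow> x = x'"
    "\<forall>y. y \<in>\<^sub>N Y \<longrightarrow> (\<exists>x. x \<in>\<^sub>N X \<and> f \<cdot> x = y)"
    by (rule same_sizeE[OF assms(1)])
  obtain g where g: "is_fun g Y Z"
    "\<forall>x x'. x \<in>\<^sub>N Y \<longrightarrow> x' \<in>\<^sub>N Y \<longrightarrow> g \<cdot> x = g \<cdot> x' \<longrightarrow> x = x'"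
    "\<forall>y. y \<in>\<^sub>N Z \<longrightarrow> (\<exists>x. x \<in>\<^sub>N Y \<and> g \<cdot> x = y)"
    by (rule same_sizeE[OF assms(2)])
  have eq: "ap g (ap f x) = g \<cdot> (f \<cdot> x)" if "x \<in>\<^sub>N X" for x
    using that ap_app[OF f(1)] ap_app[OF g(1)] app_mem(2)[OF f(1)] by simp
  show ?thesis
  proof (rule same_size_from_rule[where g = "\<lambda>x. ap g (ap f x)"])
    show "setlike (\<lambda>p. \<exists>x. x \<in>\<^sub>N X \<and> p = \<langle>x, ap g (ap f x)\<rangle>)"
      by (rule setlikeI, (rule strat_intros)+)
    show "ap g (ap f x) \<in>\<^sub>N Z" if "x \<in>\<^sub>N X" for x
      using that eq app_mem(2)[OF f(1)] app_mem(2)[OF g(1)] by simp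
    show "x = x'" if "x \<in>\<^sub>N X" "x' \<in>\<^sub>N X" "ap g (ap f x) = ap g (ap f x')" for x x'
    proof -
      have "g \<cdot> (f \<cdot> x) = g \<cdot> (f \<cdot> x')" using that(3) unfolding eq[OF that(1)] eq[OF that(2)] .
      then have "f \<cdot> x = f \<cdot> x'" using g(2) app_mem(2)[OF f(1)] that(1,2) by blast
      then show ?thesis using f(2) that(1,2) by blast
    qed
    show "\<exists>x. x \<in>\<^sub>N X \<and> ap g (ap f x) = z" if z: "z \<in>\<^sub>N Z" for z
    proof -
      obtain y where y: "y \<in>\<^sub>N Y" "g \<cdot> y = z" using g(3) z by blast
      then obtain x where x: "x \<in>\<^sub>N X" "f \<cdot> x = y" using f(3) by blast
      have "ap g (ap f x) = z" unfolding eq[OF x(1)] x(2) y(2) ..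
      then show ?thesis using x(1) by blast
    qed
  qed
qed

lemma same_size_sym:
  assumes "X \<cong> Y" shows "Y \<cong> X"
proof -
  obtain f where f: "is_fun f X Y"
    "\<forall>x x'. x \<in>\<^sub>N X \<longrightarrow> x' \<in>\<^sub>N X \<longrightarrow> f \<cdot> x = f \<cdot> x' \<longrightarrow> x = x'"
    "\<forall>y. y \<in>\<^sub>N Y \<longrightarrow> (\<exists>x. x \<in>\<^sub>N X \<and> f \<cdot> x = y)"
    by (rule same_sizeE[OF assms(1)])
  let ?P = "\<lambda>p. \<exists>x y. \<langle>x, y\<rangle> \<in>\<^sub>N f \<and> p = \<langle>y, x\<rangle>"
  have P: "?P \<langle>y, x\<rangle> \<longleftrightarrow> x \<in>\<^sub>N X \<and> y = f \<cdot> x" for x y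
    using graph_iff[OF f(1)] by simp
  have set: "setlike ?P" by (rule setlikeI, (rule strat_intros)+)
  have "is_fun (coll ?P) Y X"
  proof (rule is_fun_coll(1)[OF set])
    show "\<exists>y x. y \<in>\<^sub>N Y \<and> x \<in>\<^sub>N X \<and> p = \<langle>y, x\<rangle>" if "?P p" for p
      using that pair_mem_fun[OF f(1)] by blast
    show "\<exists>!x. ?P \<langle>y, x\<rangle>" if y: "y \<in>\<^sub>N Y" for y
    proof -
      obtain x where "x \<in>\<^sub>N X" "f \<cdot> x = y" using f(3) y by blast
      then show ?thesis unfolding P using f(2) by blast
    qed
  qed
  moreover have "\<exists>!y. \<langle>y, x\<rangle> \<in>\<^sub>N coll ?P" if "x \<in>\<^sub>N X" for x
    unfolding mem_coll[OF set] P using that by simp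
  ultimately show ?thesis unfolding same_size_def is_bij_def by blast
qed

lemma mem_Hom: "f \<in>\<^sub>N Hom X Y \<longleftrightarrow> is_fun f X Y"
  unfolding Hom_def by (rule mem_coll_strat, (rule strat_intros)+)

lemma mem_pullback:
  assumes "is_fun f X Z" "is_fun g Y Z"
  shows "p \<in>\<^sub>N pullback X f Y g \<longleftrightarrow> (\<exists>x y. x \<in>\<^sub>N X \<and> y \<in>\<^sub>N Y \<and> f \<cdot> x = g \<cdot> y \<and> p = \<langle>x, y\<rangle>)"
proof -
  have "setlike (\<lambda>p. \<exists>x y. x \<in>\<^sub>N X \<and> y \<in>\<^sub>N Y \<and> ap f x = ap g y \<and> p = \<langle>x, y\<rangle>)"
    by (rule setlikeI, (rule strat_intros)+)
  then have "setlike (\<lambda>p. \<exists>x y. x \<in>\<^sub>N X \<and> y \<in>\<^sub>N Y \<and> f \<cdot> x = g \<cdot> y \<and> p = \<langle>x, y\<rangle>)"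
    by (rule setlike_cong) (metis ap_app[OF assms(1)] ap_app[OF assms(2)])
  then show ?thesis unfolding pullback_def by (rule mem_coll)
qed

lemma pair_mem_pullback:
  assumes "is_fun f X Z" "is_fun g Y Z"
  shows "\<langle>x, y\<rangle> \<in>\<^sub>N pullback X f Y g \<longleftrightarrow> x \<in>\<^sub>N X \<and> y \<in>\<^sub>N Y \<and> f \<cdot> x = g \<cdot> y"
  unfolding mem_pullback[OF assms] by simp

text \<open>
  The map \<open>h \<mapsto> h \<cdot> a\<close> lowers the type by one; taking the singleton of the value repairs this.
\<close>

lemma Hom_singleton_same_size: "Hom (sing a) X \<cong> T X"
proof (rule same_size_from_rule[where g = "\<lambda>h. sing (ap h a)"])
  have ap: "ap h a = h \<cdot> a" "h \<cdot> a \<in>\<^sub>N X" if "h \<in>\<^sub>N Hom (sing a) X" for h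
    using that ap_app app_mem(2) unfolding mem_Hom by (metis mem_sing)+
  show "setlike (\<lambda>p. \<exists>h. h \<in>\<^sub>N Hom (sing a) X \<and> p = \<langle>h, sing (ap h a)\<rangle>)"
    by (rule setlikeI, (rule strat_intros)+)
  show "sing (ap h a) \<in>\<^sub>N T X" if "h \<in>\<^sub>N Hom (sing a) X" for h
    using ap[OF that] by simp
  show "h = h'" if "h \<in>\<^sub>N Hom (sing a) X" "h' \<in>\<^sub>N Hom (sing a) X" "sing (ap h a) = sing (ap h' a)" for h h'
    using that ap fun_ext[of h "sing a" X h' X] by (simp add: mem_Hom)
  fix z assume "z \<in>\<^sub>N T X"
  then obtain x where x: "x \<in>\<^sub>N X" "z = sing x" by auto
  have "setlike (\<lambda>p. \<exists>b. b \<in>\<^sub>N sing a \<and> p = \<langle>b, x\<rangle>)" by (rule setlikeI, (rule strat_intros)+)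
  then obtain h where "is_fun h (sing a) X" "\<forall>b. b \<in>\<^sub>N sing a \<longrightarrow> h \<cdot> b = x"
    using x(1) by (rule function_from_rule[where g = "\<lambda>_. x"])
  then show "\<exists>h. h \<in>\<^sub>N Hom (sing a) X \<and> sing (ap h a) = z"
    using ap x(2) mem_Hom by (metis mem_sing)
qed

section \<open>Natural transformations form a set\<close>

text \<open>
  What is needed of a diagram for the natural transformations out of it or into it to form a set:
  its structure maps have the right domains and codomains.
\<close>

definition typed_diagram :: "'v::nf icat \<Rightarrow> 'v idiag \<Rightarrow> bool" where
  "typed_diagram C F \<longleftrightarrow> is_fun (gam F) (F0 F) (C0 C) \<and>
     is_fun (act F) (pullback (F0 F) (gam F) (C1 C) (d0 C)) (F0 F)"

text \<open>
  The naturality square may be rewritten with \<open>ap\<close> only once \<open>t\<close> is known to lie over the object of objects;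
  otherwise \<open>\<langle>t \<cdot> x, f\<rangle>\<close> may be outside the domain of the action.
\<close>

lemma mem_NatTrans:
  assumes d0: "is_fun (d0 C) (C1 C) (C0 C)" and "typed_diagram C G" "typed_diagram C F"
  shows "t \<in>\<^sub>N NatTrans C G F \<longleftrightarrow> is_nat_trans C G F t"
proof -
  have gG: "is_fun (gam G) (F0 G) (C0 C)" and gF: "is_fun (gam F) (F0 F) (C0 C)"
    and aG: "is_fun (act G) (pullback (F0 G) (gam G) (C1 C) (d0 C)) (F0 G)"
    and aF: "is_fun (act F) (pullback (F0 F) (gam F) (C1 C) (d0 C)) (F0 F)"
    using assms(2,3) unfolding typed_diagram_def by auto
  let ?Q = "\<lambda>t. is_fun t (F0 G) (F0 F) \<and>
     (\<forall>x. x \<in>\<^sub>N F0 G \<longrightarrow> ap (gam F) (ap t x) = ap (gam G) x) \<and>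
     (\<forall>x f. x \<in>\<^sub>N F0 G \<and> f \<in>\<^sub>N C1 C \<and> ap (gam G) x = ap (d0 C) f \<longrightarrow>
        ap t (ap (act G) \<langle>x, f\<rangle>) = ap (act F) \<langle>ap t x, f\<rangle>)"
  have "setlike ?Q" by (rule setlikeI, (rule strat_intros)+)
  moreover have "is_nat_trans C G F t \<longleftrightarrow> ?Q t" for t
  proof (cases "is_fun t (F0 G) (F0 F)")
    case t: True
    have 1: "ap (gam F) (ap t x) = gam F \<cdot> (t \<cdot> x)" "ap (gam G) x = gam G \<cdot> x" "ap t x = t \<cdot> x"
      if "x \<in>\<^sub>N F0 G" for x
      using that ap_app[OF gG] ap_app[OF t] ap_app[OF gF] app_mem(2)[OF t] by simp_all
    have 2: "ap t (ap (act G) \<langle>x, f\<rangle>) = t \<cdot> (act G \<cdot> \<langle>x, f\<rangle>)"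
      "ap (act F) \<langle>ap t x, f\<rangle> = act F \<cdot> \<langle>t \<cdot> x, f\<rangle>"
      if "x \<in>\<^sub>N F0 G" "f \<in>\<^sub>N C1 C" "gam G \<cdot> x = d0 C \<cdot> f" "gam F \<cdot> (t \<cdot> x) = gam G \<cdot> x" for x f
    proof -
      have "\<langle>x, f\<rangle> \<in>\<^sub>N pullback (F0 G) (gam G) (C1 C) (d0 C)"
        using that pair_mem_pullback[OF gG d0] by simp
      then show "ap t (ap (act G) \<langle>x, f\<rangle>) = t \<cdot> (act G \<cdot> \<langle>x, f\<rangle>)"
        using ap_app[OF aG] app_mem(2)[OF aG] ap_app[OF t] by simp
      have "\<langle>t \<cdot> x, f\<rangle> \<in>\<^sub>N pullback (F0 F) (gam F) (C1 C) (d0 C)"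
        using that pair_mem_pullback[OF gF d0] app_mem(2)[OF t] by simp
      then show "ap (act F) \<langle>ap t x, f\<rangle> = act F \<cdot> \<langle>t \<cdot> x, f\<rangle>"
        using ap_app[OF aF] 1(3)[OF that(1)] by simp
    qed
    have over: "(\<forall>x. x \<in>\<^sub>N F0 G \<longrightarrow> ap (gam F) (ap t x) = ap (gam G) x) \<longleftrightarrow>
        (\<forall>x. x \<in>\<^sub>N F0 G \<longrightarrow> gam F \<cdot> (t \<cdot> x) = gam G \<cdot> x)"
      by (intro all_cong1 imp_cong refl) (simp only: 1(1,2))
    have equivariant: "(\<forall>x f. x \<in>\<^sub>N F0 G \<and> f \<in>\<^sub>N C1 C \<and> ap (gam G) x = ap (d0 C) f \<longrightarrow>
          ap t (ap (act G) \<langle>x, f\<rangle>) = ap (act F) \<langle>ap t x, f\<rangle>) \<longleftrightarrow>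
        (\<forall>x f. x \<in>\<^sub>N F0 G \<and> f \<in>\<^sub>N C1 C \<and> gam G \<cdot> x = d0 C \<cdot> f \<longrightarrow>
          t \<cdot> (act G \<cdot> \<langle>x, f\<rangle>) = act F \<cdot> \<langle>t \<cdot> x, f\<rangle>)"
      if H: "\<forall>x. x \<in>\<^sub>N F0 G \<longrightarrow> gam F \<cdot> (t \<cdot> x) = gam G \<cdot> x"
    proof (intro all_cong1 imp_cong)
      fix x f
      show "(x \<in>\<^sub>N F0 G \<and> f \<in>\<^sub>N C1 C \<and> ap (gam G) x = ap (d0 C) f) \<longleftrightarrow>
          (x \<in>\<^sub>N F0 G \<and> f \<in>\<^sub>N C1 C \<and> gam G \<cdot> x = d0 C \<cdot> f)"
        by (intro conj_cong refl) (simp only: 1(2) ap_app[OF d0])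
      assume "x \<in>\<^sub>N F0 G \<and> f \<in>\<^sub>N C1 C \<and> gam G \<cdot> x = d0 C \<cdot> f"
      then show "ap t (ap (act G) \<langle>x, f\<rangle>) = ap (act F) \<langle>ap t x, f\<rangle> \<longleftrightarrow>
          t \<cdot> (act G \<cdot> \<langle>x, f\<rangle>) = act F \<cdot> \<langle>t \<cdot> x, f\<rangle>"
        using 2[of x f] H by simp
    qed
    show ?thesis
      unfolding is_nat_trans_def over by (intro conj_cong refl equivariant[symmetric])
  qed (simp add: is_nat_trans_def)
  ultimately have "setlike (is_nat_trans C G F)" by (rule setlike_cong)
  then show ?thesis unfolding NatTrans_def by (rule mem_coll)
qed

section \<open>The Yoneda bijection\<close>

context
  fixes C :: "'v::nf icat" and a u :: 'v
  assumes cat: "internal_category C" and u_fun: "is_fun u (sing a) (C0 C)"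
begin

lemma d0_fun: "is_fun (d0 C) (C1 C) (C0 C)" and d1_fun: "is_fun (d1 C) (C1 C) (C0 C)"
  and idn_fun: "is_fun (idn C) (C0 C) (C1 C)"
  and cmp_fun: "is_fun (cmp C) (pullback (C1 C) (d1 C) (C1 C) (d0 C)) (C1 C)"
  using cat unfolding internal_category_def by auto

lemma d_idn: "b \<in>\<^sub>N C0 C \<Longrightarrow> d0 C \<cdot> (idn C \<cdot> b) = b" "b \<in>\<^sub>N C0 C \<Longrightarrow> d1 C \<cdot> (idn C \<cdot> b) = b"
  using cat unfolding internal_category_def by auto

lemma d_cmp:
  assumes "f \<in>\<^sub>N C1 C" "g \<in>\<^sub>N C1 C" "d1 C \<cdot> f = d0 C \<cdot> g"
  shows "d0 C \<cdot> (cmp C \<cdot> \<langle>f, g\<rangle>) = d0 C \<cdot> f" "d1 C \<cdot> (cmp C \<cdot> \<langle>f, g\<rangle>) = d1 C \<cdot> g"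
    "cmp C \<cdot> \<langle>f, g\<rangle> \<in>\<^sub>N C1 C" "ap (cmp C) \<langle>f, g\<rangle> = cmp C \<cdot> \<langle>f, g\<rangle>"
proof -
  show "d0 C \<cdot> (cmp C \<cdot> \<langle>f, g\<rangle>) = d0 C \<cdot> f" "d1 C \<cdot> (cmp C \<cdot> \<langle>f, g\<rangle>) = d1 C \<cdot> g"
    using cat assms unfolding internal_category_def by blast+
  have "\<langle>f, g\<rangle> \<in>\<^sub>N pullback (C1 C) (d1 C) (C1 C) (d0 C)"
    using assms by (simp add: pair_mem_pullback[OF d1_fun d0_fun])
  then show "cmp C \<cdot> \<langle>f, g\<rangle> \<in>\<^sub>N C1 C" "ap (cmp C) \<langle>f, g\<rangle> = cmp C \<cdot> \<langle>f, g\<rangle>"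
    by (rule app_mem(2)[OF cmp_fun], rule ap_app[OF cmp_fun])
qed

lemma u_mem: "u \<cdot> a \<in>\<^sub>N C0 C" using app_mem(2)[OF u_fun] by simp

lemma mem_rep_set:
  "p \<in>\<^sub>N rep_set C (sing a) u \<longleftrightarrow> (\<exists>f. f \<in>\<^sub>N C1 C \<and> d0 C \<cdot> f = u \<cdot> a \<and> p = \<langle>a, f\<rangle>)"
  unfolding rep_set_def mem_pullback[OF u_fun d0_fun] by (metis mem_sing)

lemma pair_mem_rep_set:
  "\<langle>b, f\<rangle> \<in>\<^sub>N rep_set C (sing a) u \<longleftrightarrow> b = a \<and> f \<in>\<^sub>N C1 C \<and> d0 C \<cdot> f = u \<cdot> a"
  unfolding mem_rep_set by auto

lemma rep_map:
  shows "is_fun (rep_map C (sing a) u) (rep_set C (sing a) u) (C0 C)"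
    and "\<langle>a, f\<rangle> \<in>\<^sub>N rep_set C (sing a) u \<Longrightarrow> rep_map C (sing a) u \<cdot> \<langle>a, f\<rangle> = d1 C \<cdot> f"
proof -
  let ?R = "rep_set C (sing a) u"
  let ?P = "\<lambda>p. \<exists>b f. \<langle>b, f\<rangle> \<in>\<^sub>N ?R \<and> p = \<langle>\<langle>b, f\<rangle>, d1 C \<cdot> f\<rangle>"
  have "setlike (\<lambda>p. \<exists>b f. \<langle>b, f\<rangle> \<in>\<^sub>N ?R \<and> p = \<langle>\<langle>b, f\<rangle>, ap (d1 C) f\<rangle>)"
    by (rule setlikeI, (rule strat_intros)+)
  then have set: "setlike ?P"
    by (rule setlike_cong) (metis pair_mem_rep_set ap_app[OF d1_fun])
  have 1: "\<exists>x y. x \<in>\<^sub>N ?R \<and> y \<in>\<^sub>N C0 C \<and> p = \<langle>x, y\<rangle>" if "?P p" for p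
    using that app_mem(2)[OF d1_fun] pair_mem_rep_set by metis
  have 2: "\<exists>!y. ?P \<langle>x, y\<rangle>" if "x \<in>\<^sub>N ?R" for x
    using that unfolding mem_rep_set pair_mem_rep_set by auto
  show "is_fun (rep_map C (sing a) u) ?R (C0 C)"
    unfolding rep_map_def using set 1 2 by (rule is_fun_coll(1))
  show "rep_map C (sing a) u \<cdot> \<langle>a, f\<rangle> = d1 C \<cdot> f" if "\<langle>a, f\<rangle> \<in>\<^sub>N ?R"
    unfolding rep_map_def by (rule is_fun_coll(2)[OF set 1 2]) (use that in auto)
qed

lemma rep_act_domain:
  "p \<in>\<^sub>N pullback (rep_set C (sing a) u) (rep_map C (sing a) u) (C1 C) (d0 C) \<longleftrightarrow>
    (\<exists>f g. f \<in>\<^sub>N C1 C \<and> g \<in>\<^sub>N C1 C \<and> d0 C \<cdot> f = u \<cdot> a \<and> d1 C \<cdot> f = d0 C \<cdot> g \<and> p = \<langle>\<langle>a, f\<rangle>, g\<rangle>)"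
  unfolding mem_pullback[OF rep_map(1) d0_fun] by (metis mem_rep_set rep_map(2))

lemma rep_act:
  shows "is_fun (rep_act C (sing a) u)
      (pullback (rep_set C (sing a) u) (rep_map C (sing a) u) (C1 C) (d0 C)) (rep_set C (sing a) u)"
    and "f \<in>\<^sub>N C1 C \<Longrightarrow> g \<in>\<^sub>N C1 C \<Longrightarrow> d0 C \<cdot> f = u \<cdot> a \<Longrightarrow> d1 C \<cdot> f = d0 C \<cdot> g \<Longrightarrow>
      rep_act C (sing a) u \<cdot> \<langle>\<langle>a, f\<rangle>, g\<rangle> = \<langle>a, cmp C \<cdot> \<langle>f, g\<rangle>\<rangle>"
proof -
  let ?R = "rep_set C (sing a) u"
  let ?D = "pullback ?R (rep_map C (sing a) u) (C1 C) (d0 C)"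
  let ?P = "\<lambda>p. \<exists>b f g. \<langle>\<langle>b, f\<rangle>, g\<rangle> \<in>\<^sub>N ?D \<and> p = \<langle>\<langle>\<langle>b, f\<rangle>, g\<rangle>, \<langle>b, cmp C \<cdot> \<langle>f, g\<rangle>\<rangle>\<rangle>"
  have D: "\<langle>\<langle>b, f\<rangle>, g\<rangle> \<in>\<^sub>N ?D \<longleftrightarrow>
      b = a \<and> f \<in>\<^sub>N C1 C \<and> g \<in>\<^sub>N C1 C \<and> d0 C \<cdot> f = u \<cdot> a \<and> d1 C \<cdot> f = d0 C \<cdot> g" for b f g
    unfolding rep_act_domain by auto
  have "setlike (\<lambda>p. \<exists>b f g. \<langle>\<langle>b, f\<rangle>, g\<rangle> \<in>\<^sub>N ?D \<and> p = \<langle>\<langle>\<langle>b, f\<rangle>, g\<rangle>, \<langle>b, ap (cmp C) \<langle>f, g\<rangle>\<rangle>\<rangle>)"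
    by (rule setlikeI, (rule strat_intros)+)
  then have set: "setlike ?P"
    by (rule setlike_cong) (metis D d_cmp(4))
  have 1: "\<exists>x y. x \<in>\<^sub>N ?D \<and> y \<in>\<^sub>N ?R \<and> p = \<langle>x, y\<rangle>" if "?P p" for p
    using that D d_cmp(1,3) pair_mem_rep_set by metis
  have 2: "\<exists>!y. ?P \<langle>x, y\<rangle>" if "x \<in>\<^sub>N ?D" for x
    using that unfolding D unfolding rep_act_domain by auto
  show "is_fun (rep_act C (sing a) u) ?D ?R"
    unfolding rep_act_def using set 1 2 by (rule is_fun_coll(1))
  show "rep_act C (sing a) u \<cdot> \<langle>\<langle>a, f\<rangle>, g\<rangle> = \<langle>a, cmp C \<cdot> \<langle>f, g\<rangle>\<rangle>"
    if "f \<in>\<^sub>N C1 C" "g \<in>\<^sub>N C1 C" "d0 C \<cdot> f = u \<cdot> a" "d1 C \<cdot> f = d0 C \<cdot> g"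
    unfolding rep_act_def by (rule is_fun_coll(2)[OF set 1 2]) (use that D in auto)
qed

lemma representable_typed: "typed_diagram C (representable C (sing a) u)"
  unfolding typed_diagram_def representable_def using rep_map(1) rep_act(1) by simp

context
  fixes F :: "'v idiag"
  assumes diag: "internal_diagram C F"
begin

lemma diagram_typed: "typed_diagram C F"
  using diag unfolding internal_diagram_def typed_diagram_def by blast

lemma gam_fun: "is_fun (gam F) (F0 F) (C0 C)"
  and act_fun: "is_fun (act F) (pullback (F0 F) (gam F) (C1 C) (d0 C)) (F0 F)"
  using diagram_typed unfolding typed_diagram_def by auto

lemma act_mem:
  assumes "x \<in>\<^sub>N F0 F" "f \<in>\<^sub>N C1 C" "gam F \<cdot> x = d0 C \<cdot> f"
  shows "act F \<cdot> \<langle>x, f\<rangle> \<in>\<^sub>N F0 F" "ap (act F) \<langle>x, f\<rangle> = act F \<cdot> \<langle>x, f\<rangle>"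
    "gam F \<cdot> (act F \<cdot> \<langle>x, f\<rangle>) = d1 C \<cdot> f"
proof -
  have "\<langle>x, f\<rangle> \<in>\<^sub>N pullback (F0 F) (gam F) (C1 C) (d0 C)"
    using assms by (simp add: pair_mem_pullback[OF gam_fun d0_fun])
  then show "act F \<cdot> \<langle>x, f\<rangle> \<in>\<^sub>N F0 F" "ap (act F) \<langle>x, f\<rangle> = act F \<cdot> \<langle>x, f\<rangle>"
    by (rule app_mem(2)[OF act_fun], rule ap_app[OF act_fun])
  show "gam F \<cdot> (act F \<cdot> \<langle>x, f\<rangle>) = d1 C \<cdot> f"
    using diag assms unfolding internal_diagram_def by blast
qed

lemma mem_fibre: "p \<in>\<^sub>N fibre F (sing a) u \<longleftrightarrow> (\<exists>x. x \<in>\<^sub>N F0 F \<and> gam F \<cdot> x = u \<cdot> a \<and> p = \<langle>x, a\<rangle>)"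
  unfolding fibre_def mem_pullback[OF gam_fun u_fun] by (metis mem_sing)

abbreviation (input) "R \<equiv> representable C (sing a) u"
abbreviation (input) "e \<equiv> \<langle>a, idn C \<cdot> (u \<cdot> a)\<rangle>"

lemma R_simps [simp]: "F0 R = rep_set C (sing a) u" "gam R = rep_map C (sing a) u"
  "act R = rep_act C (sing a) u"
  by (simp_all add: representable_def)

lemma idn_u: "idn C \<cdot> (u \<cdot> a) \<in>\<^sub>N C1 C" using app_mem(2)[OF idn_fun u_mem] .

lemma e_mem: "e \<in>\<^sub>N rep_set C (sing a) u"
  using idn_u d_idn(1)[OF u_mem] by (simp add: pair_mem_rep_set)

lemma nat_trans_value_at_id:
  assumes "is_nat_trans C R F t"
  shows "t \<cdot> e \<in>\<^sub>N F0 F" "gam F \<cdot> (t \<cdot> e) = u \<cdot> a"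
proof -
  have "is_fun t (rep_set C (sing a) u) (F0 F)" using assms by (simp add: is_nat_trans_def)
  then show "t \<cdot> e \<in>\<^sub>N F0 F" using e_mem by (rule app_mem(2))
  have "gam F \<cdot> (t \<cdot> e) = rep_map C (sing a) u \<cdot> e"
    using assms e_mem by (simp add: is_nat_trans_def)
  then show "gam F \<cdot> (t \<cdot> e) = u \<cdot> a" using rep_map(2)[OF e_mem] d_idn(2)[OF u_mem] by simp
qed

text \<open>
  Naturality at the identity, as \<open>f\<close> is the identity acted on by \<open>f\<close>.
\<close>

lemma nat_trans_determined:
  assumes "is_nat_trans C R F t" "f \<in>\<^sub>N C1 C" "d0 C \<cdot> f = u \<cdot> a"
  shows "t \<cdot> \<langle>a, f\<rangle> = act F \<cdot> \<langle>t \<cdot> e, f\<rangle>"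
proof -
  have id: "d1 C \<cdot> (idn C \<cdot> (u \<cdot> a)) = d0 C \<cdot> f" "d0 C \<cdot> (idn C \<cdot> (u \<cdot> a)) = u \<cdot> a"
    using d_idn u_mem assms(3) by simp_all
  have "cmp C \<cdot> \<langle>idn C \<cdot> (d0 C \<cdot> f), f\<rangle> = f"
    using cat assms(2) unfolding internal_category_def by blast
  then have "rep_act C (sing a) u \<cdot> \<langle>e, f\<rangle> = \<langle>a, f\<rangle>"
    using rep_act(2)[OF idn_u assms(2) id(2,1)] assms(3) by simp
  moreover have "rep_map C (sing a) u \<cdot> e = d0 C \<cdot> f" using rep_map(2)[OF e_mem] id by simp
  then have "t \<cdot> (rep_act C (sing a) u \<cdot> \<langle>e, f\<rangle>) = act F \<cdot> \<langle>t \<cdot> e, f\<rangle>"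
    using assms(1,2) e_mem unfolding is_nat_trans_def R_simps by blast
  ultimately show ?thesis by simp
qed

text \<open>
  The transformation takes \<open>f\<close> to \<open>x\<close> acted on by \<open>f\<close>. Naturality is the associativity of the action,
  and the value at the identity is \<open>x\<close> by its unit law.
\<close>

lemma nat_trans_from_element:
  assumes x: "x \<in>\<^sub>N F0 F" "gam F \<cdot> x = u \<cdot> a"
  obtains t where "is_nat_trans C R F t" "t \<cdot> e = x"
proof -
  let ?R = "rep_set C (sing a) u"
  let ?P = "\<lambda>p. \<exists>f. \<langle>a, f\<rangle> \<in>\<^sub>N ?R \<and> p = \<langle>\<langle>a, f\<rangle>, act F \<cdot> \<langle>x, f\<rangle>\<rangle>"
  have in_R: "f \<in>\<^sub>N C1 C" "gam F \<cdot> x = d0 C \<cdot> f" if "\<langle>a, f\<rangle> \<in>\<^sub>N ?R" for f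
    using that x unfolding pair_mem_rep_set by auto
  have "setlike (\<lambda>p. \<exists>f. \<langle>a, f\<rangle> \<in>\<^sub>N ?R \<and> p = \<langle>\<langle>a, f\<rangle>, ap (act F) \<langle>x, f\<rangle>\<rangle>)"
    by (rule setlikeI, (rule strat_intros)+)
  then have set: "setlike ?P"
    by (rule setlike_cong) (metis in_R act_mem(2) x(1))
  have 1: "\<exists>p' y. p' \<in>\<^sub>N ?R \<and> y \<in>\<^sub>N F0 F \<and> p = \<langle>p', y\<rangle>" if "?P p" for p
    using that in_R act_mem(1)[OF x(1)] by metis
  have 2: "\<exists>!y. ?P \<langle>p, y\<rangle>" if "p \<in>\<^sub>N ?R" for p
    using that unfolding mem_rep_set by auto
  have t: "is_fun (coll ?P) ?R (F0 F)" using set 1 2 by (rule is_fun_coll(1))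
  have t_eq: "coll ?P \<cdot> \<langle>a, f\<rangle> = act F \<cdot> \<langle>x, f\<rangle>" if "\<langle>a, f\<rangle> \<in>\<^sub>N ?R" for f
    by (rule is_fun_coll(2)[OF set 1 2]) (use that in auto)
  have "is_nat_trans C R F (coll ?P)"
    unfolding is_nat_trans_def R_simps
  proof (intro conjI allI impI)
    show "is_fun (coll ?P) ?R (F0 F)" by (rule t)
    fix p assume "p \<in>\<^sub>N ?R"
    then obtain f where f: "p = \<langle>a, f\<rangle>" "\<langle>a, f\<rangle> \<in>\<^sub>N ?R" unfolding mem_rep_set by blast
    then show "gam F \<cdot> (coll ?P \<cdot> p) = rep_map C (sing a) u \<cdot> p"
      using t_eq rep_map(2) act_mem(3)[OF x(1) in_R] by simp
  next
    fix p g assume *: "p \<in>\<^sub>N ?R \<and> g \<in>\<^sub>N C1 C \<and> rep_map C (sing a) u \<cdot> p = d0 C \<cdot> g"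
    then obtain f where f: "p = \<langle>a, f\<rangle>" "\<langle>a, f\<rangle> \<in>\<^sub>N ?R" unfolding mem_rep_set by blast
    have fg: "f \<in>\<^sub>N C1 C" "g \<in>\<^sub>N C1 C" "d0 C \<cdot> f = u \<cdot> a" "d1 C \<cdot> f = d0 C \<cdot> g"
      using * f rep_map(2) pair_mem_rep_set by auto
    have "\<langle>a, cmp C \<cdot> \<langle>f, g\<rangle>\<rangle> \<in>\<^sub>N ?R" using d_cmp fg by (simp add: pair_mem_rep_set)
    moreover have "act F \<cdot> \<langle>act F \<cdot> \<langle>x, f\<rangle>, g\<rangle> = act F \<cdot> \<langle>x, cmp C \<cdot> \<langle>f, g\<rangle>\<rangle>"
      using diag x fg in_R[OF f(2)] unfolding internal_diagram_def by blast
    ultimately show "coll ?P \<cdot> (rep_act C (sing a) u \<cdot> \<langle>p, g\<rangle>) = act F \<cdot> \<langle>coll ?P \<cdot> p, g\<rangle>"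
      using rep_act(2)[OF fg] t_eq f by simp
  qed
  moreover have "act F \<cdot> \<langle>x, idn C \<cdot> (gam F \<cdot> x)\<rangle> = x"
    using diag x unfolding internal_diagram_def by blast
  then have "coll ?P \<cdot> e = x" using t_eq[OF e_mem] x(2) by simp
  ultimately show ?thesis by (rule that)
qed

lemma yoneda_mem: "t \<in>\<^sub>N NatTrans C R F \<longleftrightarrow> is_nat_trans C R F t"
  by (rule mem_NatTrans[OF d0_fun representable_typed diagram_typed])

text \<open>
  Evaluation at the identity, followed by the singleton so that the map is a set.
\<close>

lemma yoneda: "NatTrans C R F \<cong> T (fibre F (sing a) u)"
proof (rule same_size_from_rule[where g = "\<lambda>t. sing \<langle>ap t e, a\<rangle>"])
  have t: "is_fun t (rep_set C (sing a) u) (F0 F)" if "t \<in>\<^sub>N NatTrans C R F" for t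
    using that by (simp add: yoneda_mem is_nat_trans_def)
  have ap: "ap t e = t \<cdot> e" if "t \<in>\<^sub>N NatTrans C R F" for t
    using ap_app[OF t[OF that] e_mem] .
  show "setlike (\<lambda>p. \<exists>t. t \<in>\<^sub>N NatTrans C R F \<and> p = \<langle>t, sing \<langle>ap t e, a\<rangle>\<rangle>)"
    by (rule setlikeI, (rule strat_intros)+)
  show "sing \<langle>ap t e, a\<rangle> \<in>\<^sub>N T (fibre F (sing a) u)" if "t \<in>\<^sub>N NatTrans C R F" for t
    using that nat_trans_value_at_id by (simp add: ap mem_fibre yoneda_mem)
  show "t = t'" if tt: "t \<in>\<^sub>N NatTrans C R F" "t' \<in>\<^sub>N NatTrans C R F"
    and eq: "sing \<langle>ap t e, a\<rangle> = sing \<langle>ap t' e, a\<rangle>" for t t'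
  proof (rule fun_ext[OF t[OF tt(1)] t[OF tt(2)]])
    fix p assume "p \<in>\<^sub>N rep_set C (sing a) u"
    then obtain f where f: "f \<in>\<^sub>N C1 C" "d0 C \<cdot> f = u \<cdot> a" "p = \<langle>a, f\<rangle>"
      unfolding mem_rep_set by blast
    then show "t \<cdot> p = t' \<cdot> p"
      using nat_trans_determined[of t f] nat_trans_determined[of t' f] tt eq
      by (simp add: ap yoneda_mem)
  qed
  show "\<exists>t. t \<in>\<^sub>N NatTrans C R F \<and> sing \<langle>ap t e, a\<rangle> = z" if z: "z \<in>\<^sub>N T (fibre F (sing a) u)" for z
  proof -
    obtain x where x: "x \<in>\<^sub>N F0 F" "gam F \<cdot> x = u \<cdot> a" "z = sing \<langle>x, a\<rangle>"
      using z by (auto simp: mem_fibre)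
    obtain t where "is_nat_trans C R F t" "t \<cdot> e = x" by (rule nat_trans_from_element[OF x(1,2)])
    then show ?thesis using x(3) ap yoneda_mem by metis
  qed
qed

end
end

theorem lemma26:
  fixes C :: "'v::nf icat" and F :: "'v idiag" and one u :: 'v
  assumes "singleton_set one"
    and "internal_category C"
    and "internal_diagram C F"
    and "is_fun u one (C0 C)"
  shows "(\<forall>t. t \<in>\<^sub>N NatTrans C (representable C one u) F \<longleftrightarrow> is_nat_trans C (representable C one u) F t)
    \<and> NatTrans C (representable C one u) F \<cong> Hom one (fibre F one u)
    \<and> Hom one (fibre F one u) \<cong> T (fibre F one u)
    \<and> (\<exists>S. set_of_singletons S \<and> NatTrans C (representable C one u) F \<cong> S)"
proof -
  obtain a where one: "one = sing a" using assms(1) unfolding singleton_set_def by blast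
  note u_fun = assms(4)[unfolded one]
  note Nat_T = yoneda[OF assms(2) u_fun assms(3)]
  have "set_of_singletons (T (fibre F one u))"
    unfolding set_of_singletons_def singleton_set_def by auto
  then show ?thesis
    unfolding one
    using yoneda_mem[OF assms(2) u_fun assms(3)] Nat_T Hom_singleton_same_size
      same_size_trans[OF Nat_T same_size_sym[OF Hom_singleton_same_size]] by blast
qed

end
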